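(* The triple $(\mathfrak{R},r,\varsigma)$ is an idempotent comonad on the category $\mathbf{C}$; that is, $(\mathfrak{R},\varsigma)$ is (essentially) a coreflector from $\mathbf{C}$ to $\mathbf{StKFrm}$, where $\mathbf{StKFrm}$ is regarded as the full subcategory of $\mathbf{C}$ on the proximity frames $(K,\ll)$ with $K$ stably compact.
   Context: A proximity on a frame $L$ is a binary relation $\prec$ on $L$ such that: (1) $a\prec b$ implies $a\le b$, and $\prec$ is a (bounded) sublattice of $L\times L$, i.e. $0\prec 0$, $1\prec 1$, and $a_1\prec b_1$, $a_2\prec b_2$ imply $a_1\wedge a_2\prec b_1\wedge b_2$ and $a_1\vee a_2\prec b_1\vee b_2$; (2) $a\le b\prec c\le d$ implies $a\prec d$; (3) $a\prec b$ implies $a\prec c\prec b$ for some $c$; (4) $a=\bigvee\{b\mid b\prec a\}$ for all $a\in L$. The pair $(L,\prec)$ is a proximity frame. $\mathbf{C}$ is the category of proximity frames and frame homomorphisms that preserve the proximities ($a\prec b\Rightarrow f(a)\prec f(b)$). The way-below relation $\ll$ on a frame: $a\ll b$ iff whenever $b\le\bigvee S$ there is a finite $F\subseteq S$ with $a\le\bigvee F$. A frame $K$ is stably compact if $1\ll1$, $a=\bigvee\{b\mid b\ll a\}$ for all $a$, and $a\ll b$, $a\ll c$ imply $a\ll b\wedge c$; then $(K,\ll)$ is a proximity frame. A frame homomorphism is proper if it preserves $\ll$. $\mathbf{StKFrm}$ is the category of stably compact frames and proper frame homomorphisms. An ideal of $L$ is a downset closed under finite joins (in particular it contains $0$). An ideal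 $I$ of a proximity frame is round if for each $a\in I$ there is $b\in I$ with $a\prec b$. $\mathfrak{R}L$ is the frame of round ideals of $L$ ordered by inclusion (a subframe of the frame of ideals of $L$); it is stably compact and is regarded as a proximity frame with proximity $\ll$. For a meet-semilattice homomorphism $f:L\to M$ between proximity frames, $\mathfrak{R}f:\mathfrak{R}L\to\mathfrak{R}M$ is $\mathfrak{R}f(I)=\{a\in M\mid a\prec f(b)\text{ for some }b\in I\}$. This makes $\mathfrak{R}$ an endofunctor on $\mathbf{C}$. $\varsigma_L:\mathfrak{R}L\to L$ is $\varsigma_L(I)=\bigvee I$; $\kappa_L:L\to\mathfrak{R}L$ is the map $\kappa_L(a)=\{b\mid b\prec a\}$; and $r_L=\mathfrak{R}(\kappa_L):\mathfrak{R}L\to\mathfrak{R}\mathfrak{R}L$, i.e. $r_L(I)=\{K\in\mathfrak{R}L\mid K\ll\kappa_L(a)\text{ for some }a\in I\}$. A comonad $(T,\delta,\epsilon)$ on a category consists of an endofunctor $T$ and natural transformations $\delta:T\to TT$, $\epsilon:T\to1$ with $T\delta\cdot\delta=\delta T\cdot\delta$ and $\epsilon T\cdot\delta=T\epsilon\cdot\delta=1_T$; it is idempotent if $\delta$ is an isomorphism. $(\mathfrak{R},\varsigma)$ being a coreflector to $\mathbf{StKFrm}$ means that $\mathfrak{R}$ takes values in this full subcategory and provides a right adjoint to its inclusion into $\mathbf{C}$, with counit $\varsigma$. *)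

theory Defs
  imports "HOL-Algebra.Complete_Lattice" "HOL-Library.FuncSet"
begin

text \<open>
  Frames are carrier-based (\<^const>\<open>complete_lattice\<close>), because the round ideals of a frame over
  \<^typ>\<open>'a\<close> form a frame over \<^typ>\<open>'a set\<close>.  Consequently the category of proximity frames has
  objects over all types, and its hom-sets connect objects over possibly different types.
  Morphisms are extensional functions on the carrier of the domain, so that equality of morphisms
  is equality of functions; composition is \<^const>\<open>compose\<close> and the identity of \<open>L\<close> is
  \<open>\<lambda>x\<in>carrier L. x\<close>.
\<close>

locale frame = complete_lattice L for L (structure) +
  assumes inf_Sup_distrib:
    "\<lbrakk>a \<in> carrier L; S \<subseteq> carrier L\<rbrakk> \<Longrightarrow> a \<sqinter> (\<Squnion> S) = \<Squnion> ((\<lambda>s. a \<sqinter> s) ` S)"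

definition frame_hom ::
  "('a, 'x) gorder_scheme \<Rightarrow> ('b, 'y) gorder_scheme \<Rightarrow> ('a \<Rightarrow> 'b) set" where
  "frame_hom L M = {f \<in> carrier L \<rightarrow>\<^sub>E carrier M.
     f \<top>\<^bsub>L\<^esub> = \<top>\<^bsub>M\<^esub> \<and>
     (\<forall>a\<in>carrier L. \<forall>b\<in>carrier L. f (a \<sqinter>\<^bsub>L\<^esub> b) = f a \<sqinter>\<^bsub>M\<^esub> f b) \<and>
     (\<forall>S\<subseteq>carrier L. f (\<Squnion>\<^bsub>L\<^esub> S) = \<Squnion>\<^bsub>M\<^esub> (f ` S))}"

definition way_below :: "('a, 'x) gorder_scheme \<Rightarrow> 'a \<Rightarrow> 'a \<Rightarrow> bool" (infixl \<open>\<lless>\<index>\<close> 50) where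
  "a \<lless>\<^bsub>L\<^esub> b \<longleftrightarrow> a \<in> carrier L \<and> b \<in> carrier L \<and>
     (\<forall>S\<subseteq>carrier L. b \<sqsubseteq>\<^bsub>L\<^esub> \<Squnion>\<^bsub>L\<^esub> S \<longrightarrow> (\<exists>F. finite F \<and> F \<subseteq> S \<and> a \<sqsubseteq>\<^bsub>L\<^esub> \<Squnion>\<^bsub>L\<^esub> F))"

locale stably_compact_frame = frame L for L (structure) +
  assumes top_way_below_top: "\<top> \<lless> \<top>"
    and way_below_approx: "a \<in> carrier L \<Longrightarrow> a = \<Squnion> {b \<in> carrier L. b \<lless> a}"
    and way_below_meet:
      "\<lbrakk>a \<in> carrier L; b \<in> carrier L; c \<in> carrier L; a \<lless> b; a \<lless> c\<rbrakk> \<Longrightarrow> a \<lless> b \<sqinter> c"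

definition proper_hom ::
  "('a, 'x) gorder_scheme \<Rightarrow> ('b, 'y) gorder_scheme \<Rightarrow> ('a \<Rightarrow> 'b) set" where
  "proper_hom K M = {f \<in> frame_hom K M.
     \<forall>a\<in>carrier K. \<forall>b\<in>carrier K. a \<lless>\<^bsub>K\<^esub> b \<longrightarrow> f a \<lless>\<^bsub>M\<^esub> f b}"

record 'a pframe = "'a gorder" +
  prox :: "'a \<Rightarrow> 'a \<Rightarrow> bool" (infixl \<open>\<prec>\<index>\<close> 50)

locale proximity_frame = frame L for L :: "('a, 'x) pframe_scheme" (structure) +
  assumes prox_le: "\<lbrakk>a \<in> carrier L; b \<in> carrier L; a \<prec> b\<rbrakk> \<Longrightarrow> a \<sqsubseteq> b"
    and prox_bottom: "\<bottom> \<prec> \<bottom>"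
    and prox_top: "\<top> \<prec> \<top>"
    and prox_meet:
      "\<lbrakk>a\<^sub>1 \<in> carrier L; b\<^sub>1 \<in> carrier L; a\<^sub>2 \<in> carrier L; b\<^sub>2 \<in> carrier L; a\<^sub>1 \<prec> b\<^sub>1; a\<^sub>2 \<prec> b\<^sub>2\<rbrakk>
        \<Longrightarrow> a\<^sub>1 \<sqinter> a\<^sub>2 \<prec> b\<^sub>1 \<sqinter> b\<^sub>2"
    and prox_join:
      "\<lbrakk>a\<^sub>1 \<in> carrier L; b\<^sub>1 \<in> carrier L; a\<^sub>2 \<in> carrier L; b\<^sub>2 \<in> carrier L; a\<^sub>1 \<prec> b\<^sub>1; a\<^sub>2 \<prec> b\<^sub>2\<rbrakk>
        \<Longrightarrow> a\<^sub>1 \<squnion> a\<^sub>2 \<prec> b\<^sub>1 \<squnion> b\<^sub>2"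
    and prox_le_trans:
      "\<lbrakk>a \<in> carrier L; b \<in> carrier L; c \<in> carrier L; d \<in> carrier L; a \<sqsubseteq> b; b \<prec> c; c \<sqsubseteq> d\<rbrakk>
        \<Longrightarrow> a \<prec> d"
    and prox_interpolate:
      "\<lbrakk>a \<in> carrier L; b \<in> carrier L; a \<prec> b\<rbrakk> \<Longrightarrow> \<exists>c\<in>carrier L. a \<prec> c \<and> c \<prec> b"
    and prox_approx: "a \<in> carrier L \<Longrightarrow> a = \<Squnion> {b \<in> carrier L. b \<prec> a}"

definition pframe_hom ::
  "('a, 'x) pframe_scheme \<Rightarrow> ('b, 'y) pframe_scheme \<Rightarrow> ('a \<Rightarrow> 'b) set" where
  "pframe_hom L M = {f \<in> frame_hom L M.
     \<forall>a\<in>carrier L. \<forall>b\<in>carrier L. a \<prec>\<^bsub>L\<^esub> b \<longrightarrow> f a \<prec>\<^bsub>M\<^esub> f b}"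

definition pframe_iso ::
  "('a, 'x) pframe_scheme \<Rightarrow> ('b, 'y) pframe_scheme \<Rightarrow> ('a \<Rightarrow> 'b) set" where
  "pframe_iso L M = {f \<in> pframe_hom L M. \<exists>g\<in>pframe_hom M L.
     compose (carrier L) g f = (\<lambda>x\<in>carrier L. x) \<and>
     compose (carrier M) f g = (\<lambda>y\<in>carrier M. y)}"

text \<open>The object part of the inclusion of stably compact frames; on morphisms it is the identity.\<close>

definition wb_pframe :: "'a gorder \<Rightarrow> 'a pframe" where
  "wb_pframe K = \<lparr>carrier = carrier K, eq = eq K, le = le K, prox = way_below K\<rparr>"

definition is_ideal :: "('a, 'x) gorder_scheme \<Rightarrow> 'a set \<Rightarrow> bool" where
  "is_ideal L I \<longleftrightarrow> I \<subseteq> carrier L \<and>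
     (\<forall>a\<in>I. \<forall>b\<in>carrier L. b \<sqsubseteq>\<^bsub>L\<^esub> a \<longrightarrow> b \<in> I) \<and>
     (\<forall>F. finite F \<and> F \<subseteq> I \<longrightarrow> \<Squnion>\<^bsub>L\<^esub> F \<in> I)"

definition is_round_ideal :: "('a, 'x) pframe_scheme \<Rightarrow> 'a set \<Rightarrow> bool" where
  "is_round_ideal L I \<longleftrightarrow> is_ideal L I \<and> (\<forall>a\<in>I. \<exists>b\<in>I. a \<prec>\<^bsub>L\<^esub> b)"

definition round_frame :: "('a, 'x) pframe_scheme \<Rightarrow> 'a set gorder" where
  "round_frame L = \<lparr>carrier = {I. is_round_ideal L I}, eq = (=), le = (\<subseteq>)\<rparr>"

definition Rd :: "('a, 'x) pframe_scheme \<Rightarrow> 'a set pframe" where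
  "Rd L = wb_pframe (round_frame L)"

definition Rd_map ::
  "('a, 'x) pframe_scheme \<Rightarrow> ('b, 'y) pframe_scheme \<Rightarrow> ('a \<Rightarrow> 'b) \<Rightarrow> 'a set \<Rightarrow> 'b set" where
  "Rd_map L M f = (\<lambda>I\<in>carrier (Rd L). {a \<in> carrier M. \<exists>b\<in>I. a \<prec>\<^bsub>M\<^esub> f b})"

definition sigma :: "('a, 'x) pframe_scheme \<Rightarrow> 'a set \<Rightarrow> 'a" where
  "sigma L = (\<lambda>I\<in>carrier (Rd L). \<Squnion>\<^bsub>L\<^esub> I)"

definition kappa :: "('a, 'x) pframe_scheme \<Rightarrow> 'a \<Rightarrow> 'a set" where
  "kappa L = (\<lambda>a\<in>carrier L. {b \<in> carrier L. b \<prec>\<^bsub>L\<^esub> a})"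

definition comult :: "('a, 'x) pframe_scheme \<Rightarrow> 'a set \<Rightarrow> 'a set set" where
  "comult L = Rd_map L (Rd L) (kappa L)"

end

theory Submission
  imports Defs
begin

text \<open>
  Way-below between round ideals is concrete: \<open>I \<lless> J\<close> iff some element of \<open>J\<close> bounds \<open>I\<close>. Hence
  \<open>comult L\<close>, which sends \<open>I\<close> to the round ideals way below some \<open>\<kappa>(a)\<close> with \<open>a \<in> I\<close>, is simply
  the map \<open>\<kappa>\<close> of \<open>Rd L\<close>. On a stably compact frame \<open>\<kappa>\<close> is inverse to \<open>\<sigma>\<close>, because a round ideal
  \<open>I\<close> for \<open>\<lless>\<close> consists of the elements way below its join. This makes the comonad idempotent, and
  \<open>Rd f \<circ> \<kappa>\<close> is the factorisation of \<open>f : K \<rightarrow> L\<close> through the counit when \<open>K\<close> is stably compact.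
\<close>

section \<open>Complete lattices\<close>

context complete_lattice
begin

text \<open>For a general proximity frame, \<open>kappa L\<close> preserves finite meets but need
  not preserve joins. It is then no morphism, and what is proved about \<open>Rd_map\<close> of a
  morphism does not apply to \<open>comult L\<close>. The identification with
  \<open>kappa (Rd L)\<close> removes this obstacle: over a stably compact frame
  \<open>kappa\<close> is the inverse of the frame homomorphism \<open>sigma\<close>, and such an
  inverse preserves all joins and the way-below relation automatically. Coassociativity also
  follows, since \<open>comult (Rd L)\<close> is by definition \<open>Rd_map\<close> of
  \<open>kappa (Rd L)\<close>. Roundness is mostly used in one way: a bound \<open>b\<close> in a
  round ideal is replaced by a member \<open>d\<close> with \<open>b \<prec> d\<close>, which turns
  \<open>\<sqsubseteq>\<close> into \<open>\<prec>\<close>. Uniqueness of the factorisation cannot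
  come from injectivity of \<open>sigma L\<close>, which fails in general. It comes from properness:
  \<open>j \<lless> k\<close> makes \<open>g j\<close> bounded by one member of \<open>g k\<close>,
  so the values of \<open>sigma L (g j)\<close> for such \<open>j\<close> recover
  \<open>g k\<close>.\<close>

lemma sup_eqI:
  assumes "A \<subseteq> carrier L" "z \<in> carrier L" "\<And>x. x \<in> A \<Longrightarrow> x \<sqsubseteq> z"
    and "\<And>u. \<lbrakk>u \<in> carrier L; \<And>x. x \<in> A \<Longrightarrow> x \<sqsubseteq> u\<rbrakk> \<Longrightarrow> z \<sqsubseteq> u"
  shows "\<Squnion>A = z"
proof (rule le_antisym)
  show "z \<sqsubseteq> \<Squnion>A" using assms by (intro assms(4)) (auto intro: weak.sup_upper)
qed (use assms in \<open>auto intro: weak.sup_least\<close>)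

lemma meet_eqI:
  assumes "a \<in> carrier L" "b \<in> carrier L" "z \<in> carrier L" "z \<sqsubseteq> a" "z \<sqsubseteq> b"
    and "\<And>u. \<lbrakk>u \<in> carrier L; u \<sqsubseteq> a; u \<sqsubseteq> b\<rbrakk> \<Longrightarrow> u \<sqsubseteq> z"
  shows "a \<sqinter> b = z"
proof (rule le_antisym)
  show "a \<sqinter> b \<sqsubseteq> z" using assms by (intro assms(6)) (auto intro: meet_left meet_right)
qed (use assms in \<open>auto intro: meet_le\<close>)

lemma top_eqI:
  assumes "z \<in> carrier L" "\<And>x. x \<in> carrier L \<Longrightarrow> x \<sqsubseteq> z"
  shows "\<top> = z"
  using assms by (intro le_antisym) auto

lemma sup_mono:
  assumes "A \<subseteq> B" "B \<subseteq> carrier L"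
  shows "\<Squnion>A \<sqsubseteq> \<Squnion>B"
  using assms by (intro weak.sup_least) (auto intro: weak.sup_upper)

lemma sup_empty_eq: "\<Squnion>{} = \<bottom>"
  by (rule sup_eqI) auto

lemma sup_insert_eq:
  assumes "a \<in> carrier L" "A \<subseteq> carrier L"
  shows "\<Squnion>(insert a A) = a \<squnion> \<Squnion>A"
  using weak.weak_sup_insert[OF assms] by (simp add: eq_is_equal)

lemma meet_absorb:
  assumes "a \<in> carrier L" "b \<in> carrier L" "a \<sqsubseteq> b"
  shows "a \<sqinter> b = a"
  using assms by (intro meet_eqI) auto

lemma join_idem: "a \<in> carrier L \<Longrightarrow> a \<squnion> a = a"
  by (simp add: join_def)

text \<open>Ideals and way-below speak of suprema of finite sets, including the empty one. This
  reduces them to \<open>\<bottom>\<close> and binary joins.\<close>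

lemma finite_sup_mem:
  assumes "finite F" "F \<subseteq> D" "D \<subseteq> carrier L" "\<bottom> \<in> D"
    and "\<And>a b. \<lbrakk>a \<in> D; b \<in> D\<rbrakk> \<Longrightarrow> a \<squnion> b \<in> D"
  shows "\<Squnion>F \<in> D"
  using assms(1,2)
proof (induction F rule: finite_induct)
  case empty
  then show ?case using assms by (simp add: sup_empty_eq)
next
  case (insert x F)
  then have "\<Squnion>(insert x F) = x \<squnion> \<Squnion>F" using assms(3) by (intro sup_insert_eq) auto
  then show ?case using insert assms by auto
qed

lemma is_idealI:
  assumes "I \<subseteq> carrier L" "\<And>a b. \<lbrakk>a \<in> I; b \<in> carrier L; b \<sqsubseteq> a\<rbrakk> \<Longrightarrow> b \<in> I"
    and "\<bottom> \<in> I" "\<And>a b. \<lbrakk>a \<in> I; b \<in> I\<rbrakk> \<Longrightarrow> a \<squnion> b \<in> I"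
  shows "is_ideal L I"
  using assms finite_sup_mem[of _ I] by (auto simp: is_ideal_def)

lemma is_ideal_bottom: "is_ideal L I \<Longrightarrow> \<bottom> \<in> I"
  unfolding is_ideal_def by (metis empty_subsetI finite.emptyI sup_empty_eq)

lemma is_ideal_join: "\<lbrakk>is_ideal L I; a \<in> I; b \<in> I\<rbrakk> \<Longrightarrow> a \<squnion> b \<in> I"
  unfolding is_ideal_def join_def by (metis empty_subsetI finite.emptyI finite.insertI insert_subset)

end

lemma is_ideal_down:
  "\<lbrakk>is_ideal L I; a \<in> I; b \<in> carrier L; b \<sqsubseteq>\<^bsub>L\<^esub> a\<rbrakk> \<Longrightarrow> b \<in> I"
  by (auto simp: is_ideal_def)

lemma is_ideal_sup: "\<lbrakk>is_ideal L I; finite F; F \<subseteq> I\<rbrakk> \<Longrightarrow> \<Squnion>\<^bsub>L\<^esub>F \<in> I"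
  by (auto simp: is_ideal_def)

lemma is_ideal_subset: "is_ideal L I \<Longrightarrow> I \<subseteq> carrier L"
  by (auto simp: is_ideal_def)

section \<open>The way-below relation\<close>

lemma way_below_carrier:
  "a \<lless>\<^bsub>L\<^esub> b \<Longrightarrow> a \<in> carrier L"
  "a \<lless>\<^bsub>L\<^esub> b \<Longrightarrow> b \<in> carrier L"
  by (auto simp: way_below_def)

lemma way_belowE:
  assumes "a \<lless>\<^bsub>L\<^esub> b" "S \<subseteq> carrier L" "b \<sqsubseteq>\<^bsub>L\<^esub> \<Squnion>\<^bsub>L\<^esub> S"
  obtains F where "finite F" "F \<subseteq> S" "a \<sqsubseteq>\<^bsub>L\<^esub> \<Squnion>\<^bsub>L\<^esub> F"
  using assms by (auto simp: way_below_def)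

context complete_lattice
begin

lemma way_below_le:
  assumes "a \<lless> b"
  shows "a \<sqsubseteq> b"
proof -
  have c: "a \<in> carrier L" "b \<in> carrier L" using assms way_below_carrier by metis+
  \<comment> \<open>The cover is the singleton \<open>{b}\<close>. The finite part may be empty, so
    its supremum is only known to lie below \<open>b\<close>.\<close>
  obtain F where "finite F" "F \<subseteq> {b}" "a \<sqsubseteq> \<Squnion>F"
    using way_belowE[OF assms, of "{b}"] c by auto
  moreover have "F \<subseteq> carrier L" using \<open>F \<subseteq> {b}\<close> c by auto
  moreover have "\<Squnion>F \<sqsubseteq> b" using c \<open>F \<subseteq> {b}\<close> by (intro weak.sup_least) auto
  ultimately show ?thesis using c by (meson le_trans weak.sup_closed)
qed

lemma way_below_trans:
  assumes "a \<in> carrier L" "d \<in> carrier L" "a \<sqsubseteq> b" "b \<lless> c" "c \<sqsubseteq> d"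
  shows "a \<lless> d"
  unfolding way_below_def
proof (intro conjI allI impI)
  fix S assume S: "S \<subseteq> carrier L" "d \<sqsubseteq> \<Squnion>S"
  have c: "b \<in> carrier L" "c \<in> carrier L" using assms way_below_carrier by metis+
  then have "c \<sqsubseteq> \<Squnion>S" using assms S by (metis le_trans weak.sup_closed)
  then obtain F where F: "finite F" "F \<subseteq> S" "b \<sqsubseteq> \<Squnion>F"
    using way_belowE[OF assms(4) S(1)] by blast
  then have "a \<sqsubseteq> \<Squnion>F" using assms c S by (meson le_trans subset_trans weak.sup_closed)
  then show "\<exists>F. finite F \<and> F \<subseteq> S \<and> a \<sqsubseteq> \<Squnion>F" using F by blast
qed (use assms in auto)

lemma way_below_bottom: "b \<in> carrier L \<Longrightarrow> \<bottom> \<lless> b"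
  unfolding way_below_def by (auto intro!: exI[of _ "{}"])

lemma way_below_join:
  assumes "a \<lless> c" "b \<lless> c"
  shows "a \<squnion> b \<lless> c"
  unfolding way_below_def
proof (intro conjI allI impI)
  have c: "a \<in> carrier L" "b \<in> carrier L" "c \<in> carrier L" using assms way_below_carrier by metis+
  then show "a \<squnion> b \<in> carrier L" "c \<in> carrier L" by auto
  fix S assume S: "S \<subseteq> carrier L" "c \<sqsubseteq> \<Squnion>S"
  obtain F where F: "finite F" "F \<subseteq> S" "a \<sqsubseteq> \<Squnion>F" using way_belowE[OF assms(1) S] by blast
  obtain G where G: "finite G" "G \<subseteq> S" "b \<sqsubseteq> \<Squnion>G" using way_belowE[OF assms(2) S] by blast
  have sub: "F \<union> G \<subseteq> carrier L" using F G S by auto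
  have "\<Squnion>F \<sqsubseteq> \<Squnion>(F \<union> G)" "\<Squnion>G \<sqsubseteq> \<Squnion>(F \<union> G)"
    using sub by (auto intro!: sup_mono)
  moreover have "\<Squnion>F \<in> carrier L" "\<Squnion>G \<in> carrier L" "\<Squnion>(F \<union> G) \<in> carrier L"
    using sub by auto
  ultimately have "a \<squnion> b \<sqsubseteq> \<Squnion>(F \<union> G)"
    using F G c by (meson join_le le_trans)
  then show "\<exists>F. finite F \<and> F \<subseteq> S \<and> a \<squnion> b \<sqsubseteq> \<Squnion>F" using F G by (intro exI[of _ "F \<union> G"]) auto
qed

lemma way_below_join_mono:
  assumes "a \<lless> c" "b \<lless> d"
  shows "a \<squnion> b \<lless> c \<squnion> d"
proof -
  have c: "a \<in> carrier L" "b \<in> carrier L" "c \<in> carrier L" "d \<in> carrier L"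
    using assms way_below_carrier by metis+
  have "a \<lless> c \<squnion> d" "b \<lless> c \<squnion> d"
    using c assms way_below_trans[of a "c \<squnion> d" a c] way_below_trans[of b "c \<squnion> d" b d]
    by (auto intro: join_left join_right)
  then show ?thesis by (rule way_below_join)
qed

text \<open>Closure of \<open>D\<close> under finite joins collapses the finite subcover provided by
  way-below into one member of \<open>D\<close>.\<close>

lemma way_below_mem:
  assumes "a \<lless> b" "b \<sqsubseteq> \<Squnion>D" "D \<subseteq> carrier L" "\<bottom> \<in> D"
    and "\<And>a b. \<lbrakk>a \<in> D; b \<in> D\<rbrakk> \<Longrightarrow> a \<squnion> b \<in> D"
  obtains d where "d \<in> D" "a \<sqsubseteq> d"
  using way_belowE[OF assms(1,3,2)] finite_sup_mem[OF _ _ assms(3-5)] by metis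

end

context stably_compact_frame
begin

text \<open>Approximation applied twice shows that the elements two way-below steps under
  \<open>b\<close> still cover \<open>b\<close>. They are closed under finite joins, so
  \<open>a\<close> lies below a single one of them, and its middle element interpolates.\<close>

lemma way_below_interpolate:
  assumes "a \<lless> b"
  obtains c where "a \<lless> c" "c \<lless> b"
proof -
  have carr: "a \<in> carrier L" "b \<in> carrier L" using assms way_below_carrier by metis+
  define D where "D = {d. \<exists>c. d \<lless> c \<and> c \<lless> b}"
  have sub: "D \<subseteq> carrier L" by (auto simp: D_def way_below_carrier)
  have "b \<sqsubseteq> \<Squnion>D"
  proof -
    have "c \<sqsubseteq> \<Squnion>D" if "c \<lless> b" for c
    proof -
      have c: "c \<in> carrier L" using that way_below_carrier by metis
      have "\<Squnion>{d \<in> carrier L. d \<lless> c} \<sqsubseteq> \<Squnion>D"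
        using sub that by (intro sup_mono) (auto simp: D_def)
      then show ?thesis using way_below_approx[OF c] by simp
    qed
    then have "\<Squnion>{c \<in> carrier L. c \<lless> b} \<sqsubseteq> \<Squnion>D"
      using sub by (intro weak.sup_least) auto
    then show ?thesis using way_below_approx[OF carr(2)] by simp
  qed
  moreover have "\<bottom> \<in> D" using carr way_below_bottom[of \<bottom>] way_below_bottom[of b] by (auto simp: D_def)
  moreover have "x \<squnion> y \<in> D" if "x \<in> D" "y \<in> D" for x y
    using that way_below_join_mono way_below_join unfolding D_def by blast
  ultimately obtain d where "d \<in> D" "a \<sqsubseteq> d" using way_below_mem[OF assms _ sub] by blast
  then obtain c where c: "d \<lless> c" "c \<lless> b" by (auto simp: D_def)
  then have "a \<lless> c" using \<open>a \<sqsubseteq> d\<close> carr way_below_trans[of a c d c] by (auto simp: way_below_carrier)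
  then show ?thesis using that c by blast
qed

end

lemma wb_pframe_simps [simp]:
  "carrier (wb_pframe K) = carrier K" "eq (wb_pframe K) = eq K" "le (wb_pframe K) = le K"
  "prox (wb_pframe K) = way_below K"
  by (auto simp: wb_pframe_def)

text \<open>Order-theoretic operations see only \<open>carrier\<close>, \<open>eq\<close> and
  \<open>le\<close>, so the added \<open>prox\<close> field changes none of them. The simp rules
  move facts between the two record types.\<close>

lemma wb_pframe_lattice [simp]:
  "Upper (wb_pframe K) = Upper K" "Lower (wb_pframe K) = Lower K"
  "least (wb_pframe K) = least K" "greatest (wb_pframe K) = greatest K"
  "Lattice.sup (wb_pframe K) = Lattice.sup K" "Lattice.inf (wb_pframe K) = Lattice.inf K"
  "join (wb_pframe K) = join K" "meet (wb_pframe K) = meet K"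
  "top (wb_pframe K) = top K" "bottom (wb_pframe K) = bottom K"
  "way_below (wb_pframe K) = way_below K"
  by (simp_all add: fun_eq_iff Upper_def Lower_def least_def greatest_def Lattice.sup_def
      Lattice.inf_def join_def meet_def top_def bottom_def way_below_def)

lemma frame_wb_pframe:
  assumes "frame K"
  shows "frame (wb_pframe K)"
proof -
  interpret frame K by fact
  show ?thesis
    by unfold_locales
      (auto simp: eq_is_equal sup_exists inf_exists inf_Sup_distrib intro: le_antisym le_trans)
qed

text \<open>The three axioms of stable compactness account for compatibility with the top,
  approximation and compatibility with meets. Interpolation is \<open>way_below_interpolate\<close>,
  and the remaining axioms hold for way-below in any complete lattice.\<close>

lemma wb_pframe_proximity_frame:
  assumes "stably_compact_frame K"
  shows "proximity_frame (wb_pframe K)"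
proof -
  interpret stably_compact_frame K by fact
  interpret W: frame "wb_pframe K" by (rule frame_wb_pframe) unfold_locales
  show ?thesis
  proof
    fix a1 b1 a2 b2
    assume *: "a1 \<in> carrier (wb_pframe K)" "b1 \<in> carrier (wb_pframe K)"
      "a2 \<in> carrier (wb_pframe K)" "b2 \<in> carrier (wb_pframe K)"
      "a1 \<prec>\<^bsub>wb_pframe K\<^esub> b1" "a2 \<prec>\<^bsub>wb_pframe K\<^esub> b2"
    then have "a1 \<sqinter>\<^bsub>K\<^esub> a2 \<lless>\<^bsub>K\<^esub> b1" "a1 \<sqinter>\<^bsub>K\<^esub> a2 \<lless>\<^bsub>K\<^esub> b2"
      using way_below_trans[of "a1 \<sqinter>\<^bsub>K\<^esub> a2" b1 a1 b1] way_below_trans[of "a1 \<sqinter>\<^bsub>K\<^esub> a2" b2 a2 b2]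
      by (auto intro: meet_left meet_right)
    then show "a1 \<sqinter>\<^bsub>wb_pframe K\<^esub> a2 \<prec>\<^bsub>wb_pframe K\<^esub> b1 \<sqinter>\<^bsub>wb_pframe K\<^esub> b2"
      using * by (auto intro: way_below_meet)
  next
    fix a b assume "a \<prec>\<^bsub>wb_pframe K\<^esub> b"
    then show "\<exists>c\<in>carrier (wb_pframe K). a \<prec>\<^bsub>wb_pframe K\<^esub> c \<and> c \<prec>\<^bsub>wb_pframe K\<^esub> b"
      using way_below_interpolate way_below_carrier by (metis wb_pframe_simps(1,4))
  qed (auto simp: way_below_approx[symmetric] top_way_below_top intro: way_below_le way_below_bottom
      way_below_join_mono way_below_trans)
qed

section \<open>The frame of round ideals\<close>

lemma round_frame_simps [simp]:
  "carrier (round_frame L) = Collect (is_round_ideal L)"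
  "le (round_frame L) = (\<subseteq>)" "eq (round_frame L) = (=)"
  by (auto simp: round_frame_def)

lemma Rd_simps [simp]:
  "carrier (Rd L) = Collect (is_round_ideal L)"
  "le (Rd L) = (\<subseteq>)" "eq (Rd L) = (=)" "prox (Rd L) = way_below (round_frame L)"
  by (auto simp: Rd_def)

lemma Rd_lattice [simp]:
  "Lattice.sup (Rd L) = Lattice.sup (round_frame L)" "meet (Rd L) = meet (round_frame L)"
  "top (Rd L) = top (round_frame L)" "way_below (Rd L) = way_below (round_frame L)"
  by (auto simp: Rd_def)

lemma round_ideal_is_ideal: "is_round_ideal L I \<Longrightarrow> is_ideal L I"
  by (simp add: is_round_ideal_def)

lemma round_ideal_subset: "is_round_ideal L I \<Longrightarrow> I \<subseteq> carrier L"
  by (simp add: is_round_ideal_def is_ideal_subset)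

lemma round_ideal_down:
  "\<lbrakk>is_round_ideal L I; a \<in> I; b \<in> carrier L; b \<sqsubseteq>\<^bsub>L\<^esub> a\<rbrakk> \<Longrightarrow> b \<in> I"
  by (meson is_round_ideal_def is_ideal_down)

lemma round_idealE:
  assumes "is_round_ideal L I" "a \<in> I"
  obtains b where "b \<in> I" "a \<prec>\<^bsub>L\<^esub> b"
  using assms by (auto simp: is_round_ideal_def)

lemma round_frame_partial_order: "partial_order (round_frame L)"
  by unfold_locales auto

text \<open>The ideal generated by \<open>\<Union>S\<close>. It becomes the join in the frame of
  round ideals. The empty \<open>F\<close> is allowed, so the span of the empty family still
  contains \<open>\<bottom>\<close>.\<close>

definition ideal_span :: "('a, 'x) gorder_scheme \<Rightarrow> 'a set set \<Rightarrow> 'a set" where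
  "ideal_span L S = {a \<in> carrier L. \<exists>F. finite F \<and> F \<subseteq> \<Union>S \<and> a \<sqsubseteq>\<^bsub>L\<^esub> \<Squnion>\<^bsub>L\<^esub> F}"

text \<open>\<open>J\<close> is an arbitrary ideal rather than a round one, because
  \<open>round_way_below_iff\<close> applies this to a principal downset.\<close>

lemma ideal_span_least:
  assumes "is_ideal L J" "\<And>I. I \<in> S \<Longrightarrow> I \<subseteq> J"
  shows "ideal_span L S \<subseteq> J"
proof
  fix a assume "a \<in> ideal_span L S"
  then obtain F where F: "finite F" "F \<subseteq> \<Union>S" "a \<sqsubseteq>\<^bsub>L\<^esub> \<Squnion>\<^bsub>L\<^esub> F" "a \<in> carrier L"
    by (auto simp: ideal_span_def)
  then have "\<Squnion>\<^bsub>L\<^esub> F \<in> J" using assms by (intro is_ideal_sup) auto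
  then show "a \<in> J" using F assms by (meson is_ideal_down)
qed

lemma (in complete_lattice) ideal_span_upper:
  assumes "I \<in> S" "I \<subseteq> carrier L"
  shows "I \<subseteq> ideal_span L S"
proof
  fix a assume "a \<in> I"
  then show "a \<in> ideal_span L S"
    using assms by (auto simp: ideal_span_def intro!: exI[of _ "{a}"])
qed

lemma (in complete_lattice) ideal_span_is_ideal:
  assumes "\<Union>S \<subseteq> carrier L"
  shows "is_ideal L (ideal_span L S)"
proof (rule is_idealI)
  show "ideal_span L S \<subseteq> carrier L" by (auto simp: ideal_span_def)
  show "b \<in> ideal_span L S" if ab: "a \<in> ideal_span L S" "b \<in> carrier L" "b \<sqsubseteq> a" for a b
  proof -
    obtain F where F: "finite F" "F \<subseteq> \<Union>S" "a \<sqsubseteq> \<Squnion>F" "a \<in> carrier L"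
      using ab by (auto simp: ideal_span_def)
    then have "\<Squnion>F \<in> carrier L" using assms by (meson subset_trans weak.sup_closed)
    then have "b \<sqsubseteq> \<Squnion>F" using F that by (meson le_trans)
    then show ?thesis using F that by (auto simp: ideal_span_def)
  qed
  show "\<bottom> \<in> ideal_span L S" by (auto simp: ideal_span_def intro!: exI[of _ "{}"])
  show "a \<squnion> b \<in> ideal_span L S" if ab: "a \<in> ideal_span L S" "b \<in> ideal_span L S" for a b
  proof -
    obtain F where F: "finite F" "F \<subseteq> \<Union>S" "a \<sqsubseteq> \<Squnion>F" "a \<in> carrier L"
      using ab by (auto simp: ideal_span_def)
    obtain G where G: "finite G" "G \<subseteq> \<Union>S" "b \<sqsubseteq> \<Squnion>G" "b \<in> carrier L"
      using ab by (auto simp: ideal_span_def)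
    have sub: "F \<union> G \<subseteq> carrier L" using F G assms by blast
    have "\<Squnion>F \<sqsubseteq> \<Squnion>(F \<union> G)" "\<Squnion>G \<sqsubseteq> \<Squnion>(F \<union> G)" using sub by (auto intro!: sup_mono)
    moreover have "\<Squnion>F \<in> carrier L" "\<Squnion>G \<in> carrier L" "\<Squnion>(F \<union> G) \<in> carrier L"
      using sub by auto
    ultimately have "a \<squnion> b \<sqsubseteq> \<Squnion>(F \<union> G)" using F G by (meson join_le le_trans)
    moreover have "finite (F \<union> G)" "F \<union> G \<subseteq> \<Union>S" using F G by auto
    moreover have "a \<squnion> b \<in> carrier L" using F(4) G(4) by simp
    ultimately show ?thesis unfolding ideal_span_def by blast
  qed
qed

text \<open>Generating the ideal adds only elements below finite joins of \<open>\<Union>S\<close>,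
  which leaves the upper bounds unchanged. This is what makes \<open>sigma\<close> preserve
  joins.\<close>

lemma (in complete_lattice) sup_ideal_span:
  assumes "\<Union>S \<subseteq> carrier L"
  shows "\<Squnion>(ideal_span L S) = \<Squnion>(\<Union>S)"
proof (rule sup_eqI)
  show sub: "ideal_span L S \<subseteq> carrier L" by (auto simp: ideal_span_def)
  show "\<Squnion>(\<Union>S) \<in> carrier L" using assms by auto
  show "a \<sqsubseteq> \<Squnion>(\<Union>S)" if ab: "a \<in> ideal_span L S" for a
  proof -
    obtain F where F: "F \<subseteq> \<Union>S" "a \<sqsubseteq> \<Squnion>F" "a \<in> carrier L"
      using ab by (auto simp: ideal_span_def)
    have "\<Squnion>F \<in> carrier L" "\<Squnion>(\<Union>S) \<in> carrier L" using F assms by (meson subset_trans weak.sup_closed)+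
    moreover have "\<Squnion>F \<sqsubseteq> \<Squnion>(\<Union>S)" using F assms by (intro sup_mono) auto
    ultimately show ?thesis using F by (meson le_trans)
  qed
  show "\<Squnion>(\<Union>S) \<sqsubseteq> u" if u: "u \<in> carrier L" "\<And>x. x \<in> ideal_span L S \<Longrightarrow> x \<sqsubseteq> u" for u
  proof (rule weak.sup_least)
    fix x assume "x \<in> \<Union>S"
    then obtain I where "I \<in> S" "x \<in> I" by auto
    moreover from this have "I \<subseteq> carrier L" using assms by auto
    ultimately show "x \<sqsubseteq> u" using ideal_span_upper[of I S] u by auto
  qed (use assms u in auto)
qed

section \<open>Joins, meets and distributivity of round ideals\<close>

context proximity_frame
begin

lemma prox_trans_le:
  "\<lbrakk>a \<in> carrier L; b \<in> carrier L; c \<in> carrier L; a \<prec> b; b \<sqsubseteq> c\<rbrakk> \<Longrightarrow> a \<prec> c"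
  by (rule prox_le_trans[of a a b c]) auto

lemma le_trans_prox:
  "\<lbrakk>a \<in> carrier L; b \<in> carrier L; c \<in> carrier L; a \<sqsubseteq> b; b \<prec> c\<rbrakk> \<Longrightarrow> a \<prec> c"
  by (rule prox_le_trans[of a b c c]) auto

lemma prox_meet_right:
  assumes "a \<in> carrier L" "b \<in> carrier L" "c \<in> carrier L" "a \<prec> b" "a \<prec> c"
  shows "a \<prec> b \<sqinter> c"
  using prox_meet[of a b a c] assms by (simp add: meet_absorb)

lemma prox_join_left:
  assumes "a \<in> carrier L" "b \<in> carrier L" "c \<in> carrier L" "a \<prec> c" "b \<prec> c"
  shows "a \<squnion> b \<prec> c"
  using prox_join[of a c b c] assms by (simp add: join_idem)

lemma prox_bottom_left: "a \<in> carrier L \<Longrightarrow> \<bottom> \<prec> a"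
  using prox_bottom prox_trans_le[of \<bottom> \<bottom> a] by auto

lemma prox_top_right: "a \<in> carrier L \<Longrightarrow> a \<prec> \<top>"
  using prox_top le_trans_prox[of a \<top> \<top>] by auto

text \<open>Each member of \<open>F\<close> is moved up along \<open>\<prec>\<close> inside
  \<open>U\<close>, and \<open>prox_join\<close> and \<open>prox_bottom\<close> assemble the steps.
  Applied with \<open>U = \<Union>S\<close>, this makes the span of round ideals round.\<close>

lemma finite_sup_prox:
  assumes "finite F" "F \<subseteq> U" "U \<subseteq> carrier L" "\<And>x. x \<in> U \<Longrightarrow> \<exists>y\<in>U. x \<prec> y"
  shows "\<exists>G. finite G \<and> G \<subseteq> U \<and> \<Squnion>F \<prec> \<Squnion>G"
  using assms(1,2)
proof (induction F rule: finite_induct)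
  case empty
  then show ?case using prox_bottom by (intro exI[of _ "{}"]) (auto simp: sup_empty_eq)
next
  case (insert x F)
  then obtain G where G: "finite G" "G \<subseteq> U" "\<Squnion>F \<prec> \<Squnion>G" by auto
  obtain y where y: "y \<in> U" "x \<prec> y" using insert assms by blast
  have c: "x \<in> carrier L" "y \<in> carrier L" "F \<subseteq> carrier L" "G \<subseteq> carrier L"
    using insert y G assms(3) by auto
  then have "\<Squnion>(insert x F) \<prec> \<Squnion>(insert y G)"
    using prox_join[of x y "\<Squnion>F" "\<Squnion>G"] y G by (auto simp: sup_insert_eq)
  then show ?case using G y by (intro exI[of _ "insert y G"]) auto
qed

lemma ideal_span_is_round:
  assumes "S \<subseteq> Collect (is_round_ideal L)"
  shows "is_round_ideal L (ideal_span L S)"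
  unfolding is_round_ideal_def
proof (intro conjI ballI)
  have sub: "\<Union>S \<subseteq> carrier L" using assms round_ideal_subset by fastforce
  then show "is_ideal L (ideal_span L S)" by (rule ideal_span_is_ideal)
  fix a assume "a \<in> ideal_span L S"
  then obtain F where F: "finite F" "F \<subseteq> \<Union>S" "a \<sqsubseteq> \<Squnion>F" "a \<in> carrier L"
    by (auto simp: ideal_span_def)
  have "\<exists>y\<in>\<Union>S. x \<prec> y" if "x \<in> \<Union>S" for x
    using that assms unfolding is_round_ideal_def by blast
  then obtain G where G: "finite G" "G \<subseteq> \<Union>S" "\<Squnion>F \<prec> \<Squnion>G"
    using finite_sup_prox[OF F(1,2) sub] by blast
  have c: "\<Squnion>F \<in> carrier L" "\<Squnion>G \<in> carrier L"
    using F G sub by (meson subset_trans weak.sup_closed)+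
  have "a \<prec> \<Squnion>G" using le_trans_prox[of a "\<Squnion>F" "\<Squnion>G"] F G c by auto
  moreover have "\<Squnion>G \<in> ideal_span L S" using G c unfolding ideal_span_def by blast
  ultimately show "\<exists>b\<in>ideal_span L S. a \<prec> b" by blast
qed

lemma round_frame_complete_lattice: "complete_lattice (round_frame L)"
proof -
  interpret R: partial_order "round_frame L" by (rule round_frame_partial_order)
  have *: "least (round_frame L) (ideal_span L S) (Upper (round_frame L) S)"
    if "S \<subseteq> Collect (is_round_ideal L)" for S
  proof (rule least_UpperI)
    show "I \<sqsubseteq>\<^bsub>round_frame L\<^esub> ideal_span L S" if "I \<in> S" for I
      using ideal_span_upper[of I S] that \<open>S \<subseteq> _\<close> round_ideal_subset by fastforce
    show "ideal_span L S \<sqsubseteq>\<^bsub>round_frame L\<^esub> J" if "J \<in> Upper (round_frame L) S" for J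
      using ideal_span_least[of L J S] that \<open>S \<subseteq> _\<close> by (auto simp: Upper_def round_ideal_is_ideal)
  qed (use that ideal_span_is_round in auto)
  show ?thesis
  proof (rule R.complete_latticeI)
    show "\<exists>s. least (round_frame L) s (Upper (round_frame L) A)"
      if "A \<subseteq> carrier (round_frame L)" for A using *[of A] that by auto
    show "\<exists>i. greatest (round_frame L) i (Lower (round_frame L) A)"
      if A: "A \<subseteq> carrier (round_frame L)" for A
    proof -
      have l: "Lower (round_frame L) A \<subseteq> Collect (is_round_ideal L)"
        using Lower_closed[of "round_frame L" A] by simp
      \<comment> \<open>An infinite intersection of round ideals need not be round, so the infimum
        is built as the join of all lower bounds.\<close>
      have "greatest (round_frame L) (ideal_span L (Lower (round_frame L) A)) (Lower (round_frame L) A)"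
      proof (rule greatest_LowerI)
        show "ideal_span L (Lower (round_frame L) A) \<sqsubseteq>\<^bsub>round_frame L\<^esub> J" if "J \<in> A" for J
        proof -
          have "ideal_span L (Lower (round_frame L) A) \<subseteq> J"
            using that A by (intro ideal_span_least) (auto simp: Lower_def round_ideal_is_ideal)
          then show ?thesis by simp
        qed
        show "J \<sqsubseteq>\<^bsub>round_frame L\<^esub> ideal_span L (Lower (round_frame L) A)"
          if "J \<in> Lower (round_frame L) A" for J
          using ideal_span_upper[OF that] that l round_ideal_subset by force
      qed (use A l ideal_span_is_round in auto)
      then show ?thesis by blast
    qed
  qed
qed

lemma round_frame_sup:
  assumes "S \<subseteq> Collect (is_round_ideal L)"
  shows "\<Squnion>\<^bsub>round_frame L\<^esub> S = ideal_span L S"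
proof -
  interpret R: complete_lattice "round_frame L" by (rule round_frame_complete_lattice)
  show ?thesis
  proof (rule R.sup_eqI)
    show "I \<sqsubseteq>\<^bsub>round_frame L\<^esub> ideal_span L S" if "I \<in> S" for I
      using ideal_span_upper[of I S] that assms round_ideal_subset by fastforce
    show "ideal_span L S \<sqsubseteq>\<^bsub>round_frame L\<^esub> J"
      if "J \<in> carrier (round_frame L)" "\<And>x. x \<in> S \<Longrightarrow> x \<sqsubseteq>\<^bsub>round_frame L\<^esub> J" for J
      using ideal_span_least[of L J S] that by (auto simp: round_ideal_is_ideal)
  qed (use assms ideal_span_is_round in auto)
qed

text \<open>The witnesses of roundness in \<open>I\<close> and in \<open>J\<close> are combined by
  their meet, which lies in both ideals and is still above \<open>a\<close> in the proximity by
  \<open>prox_meet_right\<close>.\<close>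

lemma round_ideal_Int:
  assumes "is_round_ideal L I" "is_round_ideal L J"
  shows "is_round_ideal L (I \<inter> J)"
  unfolding is_round_ideal_def
proof (intro conjI ballI)
  show "is_ideal L (I \<inter> J)"
    using assms by (auto simp: is_round_ideal_def is_ideal_def)
  fix a assume a: "a \<in> I \<inter> J"
  obtain b c where bc: "b \<in> I" "a \<prec> b" "c \<in> J" "a \<prec> c"
    using a assms by (meson IntD1 IntD2 round_idealE)
  have carr: "a \<in> carrier L" "b \<in> carrier L" "c \<in> carrier L"
    using a bc assms round_ideal_subset by blast+
  have "b \<sqinter> c \<in> I" "b \<sqinter> c \<in> J"
    using bc carr assms by (auto intro: round_ideal_down meet_left meet_right)
  then show "\<exists>d\<in>I \<inter> J. a \<prec> d" using prox_meet_right carr bc by blast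
qed

lemma round_frame_meet:
  assumes "is_round_ideal L I" "is_round_ideal L J"
  shows "I \<sqinter>\<^bsub>round_frame L\<^esub> J = I \<inter> J"
proof -
  interpret R: complete_lattice "round_frame L" by (rule round_frame_complete_lattice)
  show ?thesis by (rule R.meet_eqI) (use assms round_ideal_Int in auto)
qed

lemma round_ideal_carrier: "is_round_ideal L (carrier L)"
  unfolding is_round_ideal_def
  by (auto intro!: is_idealI bexI[of _ \<top>] prox_top_right)

lemma round_frame_top: "\<top>\<^bsub>round_frame L\<^esub> = carrier L"
proof -
  interpret R: complete_lattice "round_frame L" by (rule round_frame_complete_lattice)
  show ?thesis by (rule R.top_eqI) (auto simp: round_ideal_carrier dest: round_ideal_subset)
qed

lemma round_frame_frame: "frame (round_frame L)"
proof -
  interpret R: complete_lattice "round_frame L" by (rule round_frame_complete_lattice)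
  show ?thesis
  proof
    fix I S assume IS: "I \<in> carrier (round_frame L)" "S \<subseteq> carrier (round_frame L)"
    have eq: "(\<lambda>J. I \<sqinter>\<^bsub>round_frame L\<^esub> J) ` S = (\<lambda>J. I \<inter> J) ` S"
      using IS by (intro image_cong) (auto simp: round_frame_meet)
    have sub: "(\<lambda>J. I \<inter> J) ` S \<subseteq> Collect (is_round_ideal L)"
      using IS by (auto intro: round_ideal_Int)
    have carr: "I \<subseteq> carrier L" "\<Union>S \<subseteq> carrier L"
      using IS round_ideal_subset by fastforce+
    have "I \<inter> ideal_span L S = ideal_span L ((\<lambda>J. I \<inter> J) ` S)"
    proof
      show "ideal_span L ((\<lambda>J. I \<inter> J) ` S) \<subseteq> I \<inter> ideal_span L S"
      proof (rule ideal_span_least)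
        show "is_ideal L (I \<inter> ideal_span L S)"
          using IS ideal_span_is_round[of S] by (intro round_ideal_is_ideal round_ideal_Int) auto
        fix J assume "J \<in> (\<lambda>J. I \<inter> J) ` S"
        then obtain J' where J': "J' \<in> S" "J = I \<inter> J'" by auto
        then have "J' \<subseteq> ideal_span L S" using carr by (intro ideal_span_upper) auto
        then show "J \<subseteq> I \<inter> ideal_span L S" using J' by auto
      qed
      show "I \<inter> ideal_span L S \<subseteq> ideal_span L ((\<lambda>J. I \<inter> J) ` S)"
      proof
        fix a assume "a \<in> I \<inter> ideal_span L S"
        then obtain F where F: "finite F" "F \<subseteq> \<Union>S" "a \<sqsubseteq> \<Squnion>F" "a \<in> carrier L" "a \<in> I"
          by (auto simp: ideal_span_def)
        have Fc: "F \<subseteq> carrier L" using F carr by blast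
        \<comment> \<open>The element is distributed over the finite set that generates it: for
          \<open>x\<close> in a member \<open>J\<close> of \<open>S\<close>, the piece
          \<open>a \<sqinter> x\<close> lies in \<open>I\<close> because of \<open>a\<close> and in
          \<open>J\<close> because of \<open>x\<close>.\<close>
        have "a = a \<sqinter> \<Squnion>F" using F Fc by (simp add: meet_absorb)
        also have "\<dots> = \<Squnion>((\<lambda>x. a \<sqinter> x) ` F)" using F Fc by (intro inf_Sup_distrib)
        finally have "a \<sqsubseteq> \<Squnion>((\<lambda>x. a \<sqinter> x) ` F)" using F by auto
        moreover have "(\<lambda>x. a \<sqinter> x) ` F \<subseteq> \<Union>((\<lambda>J. I \<inter> J) ` S)"
        proof
          fix y assume "y \<in> (\<lambda>x. a \<sqinter> x) ` F"
          then obtain x J where x: "x \<in> J" "J \<in> S" "y = a \<sqinter> x" using F by blast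
          have c: "x \<in> carrier L" using x carr by auto
          have "y \<in> I" "y \<in> J"
            using x c F IS by (auto intro!: round_ideal_down[of L I a] round_ideal_down[of L J x]
                meet_left meet_right)
          then show "y \<in> \<Union>((\<lambda>J. I \<inter> J) ` S)" using x by auto
        qed
        ultimately show "a \<in> ideal_span L ((\<lambda>J. I \<inter> J) ` S)"
          using F unfolding ideal_span_def by blast
      qed
    qed
    then show "I \<sqinter>\<^bsub>round_frame L\<^esub> (\<Squnion>\<^bsub>round_frame L\<^esub> S) =
        \<Squnion>\<^bsub>round_frame L\<^esub> ((\<lambda>s. I \<sqinter>\<^bsub>round_frame L\<^esub> s) ` S)"
      unfolding eq using IS sub by (simp add: round_frame_sup round_frame_meet ideal_span_is_round)
  qed
qed

section \<open>The round ideals given by \<open>kappa\<close> and the way-below relation between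
  round ideals\<close>

lemma kappa_apply: "a \<in> carrier L \<Longrightarrow> kappa L a = {b \<in> carrier L. b \<prec> a}"
  by (simp add: kappa_def)

text \<open>Roundness here is exactly interpolation in \<open>L\<close>, and the ideal laws are
  compatibility of the proximity with order and joins.\<close>

lemma kappa_is_round:
  assumes "a \<in> carrier L"
  shows "is_round_ideal L (kappa L a)"
  unfolding is_round_ideal_def
proof (intro conjI ballI)
  show "is_ideal L (kappa L a)"
    using assms by (intro is_idealI)
      (auto simp: kappa_apply prox_bottom_left intro: prox_join_left le_trans_prox)
  fix b assume "b \<in> kappa L a"
  then show "\<exists>c\<in>kappa L a. b \<prec> c"
    using assms prox_interpolate[of b a] by (auto simp: kappa_apply)
qed

lemma kappa_subset:
  assumes "is_round_ideal L I" "a \<in> I"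
  shows "kappa L a \<subseteq> I"
proof -
  have "a \<in> carrier L" using assms round_ideal_subset by blast
  then show ?thesis using assms by (auto simp: kappa_apply intro: round_ideal_down prox_le)
qed

text \<open>By roundness each member of \<open>I\<close> lies in \<open>kappa L b\<close> for
  another member \<open>b\<close>. This gives the standard cover of \<open>I\<close>, used as the
  test cover for way-below and for approximation in the frame of round ideals.\<close>

lemma round_ideal_eq_span:
  assumes "is_round_ideal L I"
  shows "I = ideal_span L (kappa L ` I)"
proof
  have c: "I \<subseteq> carrier L" using assms by (rule round_ideal_subset)
  show "ideal_span L (kappa L ` I) \<subseteq> I"
    using assms by (intro ideal_span_least) (auto dest: kappa_subset simp: round_ideal_is_ideal)
  show "I \<subseteq> ideal_span L (kappa L ` I)"
  proof
    fix a assume a: "a \<in> I"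
    then obtain b where b: "b \<in> I" "a \<prec> b" using assms by (meson round_idealE)
    then have "b \<in> carrier L" using c by auto
    then have "a \<in> kappa L b" using a b c by (auto simp: kappa_apply)
    then show "a \<in> ideal_span L (kappa L ` I)"
      using ideal_span_upper[of "kappa L b" "kappa L ` I"] b c round_ideal_subset[OF kappa_is_round]
      by blast
  qed
qed

text \<open>Forwards, \<open>J\<close> is covered by the ideals \<open>kappa L b\<close> with
  \<open>b \<in> J\<close>; a finite subcover is bounded by the join of finitely many such
  \<open>b\<close>, which is still in \<open>J\<close>. Backwards, the bound \<open>b\<close> is an
  element of any covering span, hence lies below a finite join, and only finitely many ideals are
  needed to contain that finite set.\<close>

lemma round_way_below_iff:
  "I \<lless>\<^bsub>round_frame L\<^esub> J \<longleftrightarrow>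
    is_round_ideal L I \<and> is_round_ideal L J \<and> (\<exists>b\<in>J. \<forall>a\<in>I. a \<sqsubseteq> b)"
proof (intro iffI conjI)
  interpret R: complete_lattice "round_frame L" by (rule round_frame_complete_lattice)
  assume IJ: "I \<lless>\<^bsub>round_frame L\<^esub> J"
  then show I: "is_round_ideal L I" and J: "is_round_ideal L J"
    by (auto dest: way_below_carrier)
  have c: "J \<subseteq> carrier L" using J by (rule round_ideal_subset)
  have sub: "kappa L ` J \<subseteq> Collect (is_round_ideal L)" using c kappa_is_round by auto
  have "J \<sqsubseteq>\<^bsub>round_frame L\<^esub> \<Squnion>\<^bsub>round_frame L\<^esub> (kappa L ` J)"
    using round_ideal_eq_span[OF J] sub by (simp add: round_frame_sup)
  then obtain \<F> where F: "finite \<F>" "\<F> \<subseteq> kappa L ` J" "I \<subseteq> \<Squnion>\<^bsub>round_frame L\<^esub> \<F>"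
    using way_belowE[OF IJ, of "kappa L ` J"] sub by auto
  obtain B where B: "finite B" "B \<subseteq> J" "\<F> = kappa L ` B" using F finite_subset_image by metis
  have b: "\<Squnion>B \<in> J" using B J by (meson is_ideal_sup round_ideal_is_ideal)
  have Bc: "B \<subseteq> carrier L" using B c by auto
  have "a \<sqsubseteq> \<Squnion>B" if "a \<in> I" for a
  proof -
    have "a \<in> ideal_span L (kappa L ` B)" using F B sub that by (auto simp: round_frame_sup)
    \<comment> \<open>Every \<open>kappa L b\<close> with \<open>b \<in> B\<close> lies in the
      principal ideal below \<open>\<Squnion>B\<close>, so the ideal they generate does too.\<close>
    moreover have "ideal_span L (kappa L ` B) \<subseteq> {x \<in> carrier L. x \<sqsubseteq> \<Squnion>B}"
    proof (rule ideal_span_least)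
      show "is_ideal L {x \<in> carrier L. x \<sqsubseteq> \<Squnion>B}"
        using Bc by (intro is_idealI) (auto intro: le_trans join_le)
      fix I assume "I \<in> kappa L ` B"
      then obtain b where b: "b \<in> B" "I = kappa L b" by auto
      then have "b \<in> carrier L" "b \<sqsubseteq> \<Squnion>B" using Bc by (auto intro: weak.sup_upper)
      then show "I \<subseteq> {x \<in> carrier L. x \<sqsubseteq> \<Squnion>B}"
        using b Bc by (auto simp: kappa_apply intro: prox_le le_trans[of _ b])
    qed
    ultimately show ?thesis by auto
  qed
  then show "\<exists>b\<in>J. \<forall>a\<in>I. a \<sqsubseteq> b" using b by auto
next
  assume "is_round_ideal L I \<and> is_round_ideal L J \<and> (\<exists>b\<in>J. \<forall>a\<in>I. a \<sqsubseteq> b)"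
  then obtain b where I: "is_round_ideal L I" and J: "is_round_ideal L J"
    and b: "b \<in> J" "\<And>a. a \<in> I \<Longrightarrow> a \<sqsubseteq> b" by auto
  show "I \<lless>\<^bsub>round_frame L\<^esub> J"
    unfolding way_below_def
  proof (intro conjI allI impI)
    fix S assume S: "S \<subseteq> carrier (round_frame L)" "J \<sqsubseteq>\<^bsub>round_frame L\<^esub> \<Squnion>\<^bsub>round_frame L\<^esub> S"
    then have "b \<in> ideal_span L S" using b by (auto simp: round_frame_sup)
    then obtain F where F: "finite F" "F \<subseteq> \<Union>S" "b \<sqsubseteq> \<Squnion>F" "b \<in> carrier L"
      by (auto simp: ideal_span_def)
    obtain \<F> where \<F>: "finite \<F>" "\<F> \<subseteq> S" "F \<subseteq> \<Union>\<F>"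
      using finite_subset_Union[OF F(1,2)] by blast
    have "b \<in> ideal_span L \<F>" using F \<F> by (auto simp: ideal_span_def)
    moreover have "is_round_ideal L (ideal_span L \<F>)"
      using \<F> S by (intro ideal_span_is_round) auto
    ultimately have "I \<subseteq> ideal_span L \<F>"
      using b round_ideal_subset[OF I] by (auto intro: round_ideal_down)
    then show "\<exists>F. finite F \<and> F \<subseteq> S \<and> I \<sqsubseteq>\<^bsub>round_frame L\<^esub> \<Squnion>\<^bsub>round_frame L\<^esub> F"
      using \<F> S by (intro exI[of _ \<F>]) (auto simp: round_frame_sup)
  qed (use I J in auto)
qed

lemma kappa_way_below:
  assumes "is_round_ideal L I" "a \<in> I"
  shows "kappa L a \<lless>\<^bsub>round_frame L\<^esub> I"
  unfolding round_way_below_iff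
  using assms round_ideal_subset[OF assms(1)]
  by (auto simp: kappa_is_round) (auto simp: kappa_apply intro!: bexI[of _ a] prox_le)

text \<open>All three axioms are read off from the bound criterion: \<open>\<top>\<close> bounds the
  whole carrier, the ideals \<open>kappa L a\<close> with \<open>a \<in> I\<close> are way below
  \<open>I\<close> and generate it, and bounds taken in \<open>J\<close> and in \<open>K\<close>
  have their meet in both.\<close>

lemma round_frame_stably_compact: "stably_compact_frame (round_frame L)"
proof -
  interpret R: frame "round_frame L" by (rule round_frame_frame)
  show ?thesis
  proof
    show "\<top>\<^bsub>round_frame L\<^esub> \<lless>\<^bsub>round_frame L\<^esub> \<top>\<^bsub>round_frame L\<^esub>"
      by (auto simp: round_frame_top round_way_below_iff round_ideal_carrier intro!: bexI[of _ \<top>])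
  next
    fix I assume I: "I \<in> carrier (round_frame L)"
    have "I = \<Squnion>\<^bsub>round_frame L\<^esub> (kappa L ` I)"
      using I kappa_is_round round_ideal_subset[of L I] round_ideal_eq_span[of I]
      by (subst round_frame_sup) auto
    moreover have "\<Squnion>\<^bsub>round_frame L\<^esub> (kappa L ` I) \<sqsubseteq>\<^bsub>round_frame L\<^esub>
        \<Squnion>\<^bsub>round_frame L\<^esub> {J \<in> carrier (round_frame L). J \<lless>\<^bsub>round_frame L\<^esub> I}"
      using I kappa_way_below[of I] kappa_is_round round_ideal_subset[of L I]
      by (intro R.sup_mono) auto
    moreover have "\<Squnion>\<^bsub>round_frame L\<^esub> {J \<in> carrier (round_frame L). J \<lless>\<^bsub>round_frame L\<^esub> I}
        \<sqsubseteq>\<^bsub>round_frame L\<^esub> I"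
      using I R.way_below_le by (intro R.weak.sup_least) auto
    ultimately show "I = \<Squnion>\<^bsub>round_frame L\<^esub> {J \<in> carrier (round_frame L). J \<lless>\<^bsub>round_frame L\<^esub> I}"
      by auto
  next
    fix I J K
    assume *: "I \<lless>\<^bsub>round_frame L\<^esub> J" "I \<lless>\<^bsub>round_frame L\<^esub> K"
    then have r: "is_round_ideal L I" "is_round_ideal L J" "is_round_ideal L K"
      by (auto simp: round_way_below_iff)
    obtain b c where bc: "b \<in> J" "c \<in> K" "\<And>a. a \<in> I \<Longrightarrow> a \<sqsubseteq> b" "\<And>a. a \<in> I \<Longrightarrow> a \<sqsubseteq> c"
      using * by (auto simp: round_way_below_iff)
    have carr: "b \<in> carrier L" "c \<in> carrier L" "I \<subseteq> carrier L"
      using bc r round_ideal_subset by blast+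
    have "b \<sqinter> c \<in> J" "b \<sqinter> c \<in> K"
      using bc carr r by (auto intro: round_ideal_down meet_left meet_right)
    moreover have "a \<sqsubseteq> b \<sqinter> c" if "a \<in> I" for a
      using bc carr that by (intro meet_le) auto
    ultimately show "I \<lless>\<^bsub>round_frame L\<^esub> J \<sqinter>\<^bsub>round_frame L\<^esub> K"
      using r by (auto simp: round_frame_meet round_way_below_iff round_ideal_Int)
  qed
qed

lemma Rd_proximity_frame: "proximity_frame (Rd L)"
  unfolding Rd_def by (rule wb_pframe_proximity_frame[OF round_frame_stably_compact])

end

section \<open>Homomorphisms\<close>

lemma frame_homD:
  assumes "f \<in> frame_hom L M"
  shows "f \<in> carrier L \<rightarrow>\<^sub>E carrier M" "f \<top>\<^bsub>L\<^esub> = \<top>\<^bsub>M\<^esub>"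
    "\<lbrakk>a \<in> carrier L; b \<in> carrier L\<rbrakk> \<Longrightarrow> f (a \<sqinter>\<^bsub>L\<^esub> b) = f a \<sqinter>\<^bsub>M\<^esub> f b"
    "S \<subseteq> carrier L \<Longrightarrow> f (\<Squnion>\<^bsub>L\<^esub> S) = \<Squnion>\<^bsub>M\<^esub> (f ` S)"
  using assms by (auto simp: frame_hom_def)

lemma frame_hom_closed: "\<lbrakk>f \<in> frame_hom L M; a \<in> carrier L\<rbrakk> \<Longrightarrow> f a \<in> carrier M"
  by (auto simp: frame_hom_def)

lemma frame_hom_mono:
  assumes "complete_lattice L" "complete_lattice M" "f \<in> frame_hom L M"
    and "a \<in> carrier L" "b \<in> carrier L" "a \<sqsubseteq>\<^bsub>L\<^esub> b"
  shows "f a \<sqsubseteq>\<^bsub>M\<^esub> f b"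
proof -
  interpret L: complete_lattice L by fact
  interpret M: complete_lattice M by fact
  have "f a = f (a \<sqinter>\<^bsub>L\<^esub> b)" using assms by (simp add: L.meet_absorb)
  also have "\<dots> = f a \<sqinter>\<^bsub>M\<^esub> f b" using assms by (simp add: frame_homD)
  finally show ?thesis using M.meet_right[of "f a" "f b"] assms frame_hom_closed by metis
qed

text \<open>Each identity for \<open>g\<close> follows by applying \<open>g\<close> to the
  corresponding identity for \<open>f\<close> at preimages. It is used with \<open>f\<close> the
  counit, so that \<open>kappa\<close> inherits preservation of joins.\<close>

lemma frame_hom_inverse:
  assumes "complete_lattice L" "f \<in> frame_hom L M" "g \<in> carrier M \<rightarrow>\<^sub>E carrier L"
    and gf: "\<And>a. a \<in> carrier L \<Longrightarrow> g (f a) = a" and fg: "\<And>b. b \<in> carrier M \<Longrightarrow> f (g b) = b"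
  shows "g \<in> frame_hom M L"
  unfolding frame_hom_def
proof (intro CollectI conjI ballI allI impI)
  interpret L: complete_lattice L by fact
  have g: "g b \<in> carrier L" if "b \<in> carrier M" for b using that assms by auto
  show "g \<top>\<^bsub>M\<^esub> = \<top>\<^bsub>L\<^esub>" using gf[of "\<top>\<^bsub>L\<^esub>"] frame_homD(2)[OF assms(2)] by simp
  show "g (a \<sqinter>\<^bsub>M\<^esub> b) = g a \<sqinter>\<^bsub>L\<^esub> g b" if "a \<in> carrier M" "b \<in> carrier M" for a b
    using gf[of "g a \<sqinter>\<^bsub>L\<^esub> g b"] frame_homD(3)[OF assms(2), of "g a" "g b"] that g fg by simp
  show "g (\<Squnion>\<^bsub>M\<^esub> S) = \<Squnion>\<^bsub>L\<^esub> (g ` S)" if "S \<subseteq> carrier M" for S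
  proof -
    have sub: "g ` S \<subseteq> carrier L" using g that by auto
    have "f ` g ` S = S" using fg that by (force simp: image_image)
    then show ?thesis using gf[of "\<Squnion>\<^bsub>L\<^esub> (g ` S)"] frame_homD(4)[OF assms(2) sub] sub by simp
  qed
qed (use assms in auto)

text \<open>Way-below depends only on the order, which \<open>f\<close> and \<open>g\<close> carry
  back and forth: a cover of \<open>g b\<close> is pushed along \<open>f\<close> to a cover of
  \<open>b\<close>, and a finite part is pulled back along \<open>g\<close>.\<close>

lemma frame_hom_inverse_way_below:
  assumes "complete_lattice L" "complete_lattice M" "f \<in> frame_hom L M" "g \<in> frame_hom M L"
    and gf: "\<And>a. a \<in> carrier L \<Longrightarrow> g (f a) = a" and fg: "\<And>b. b \<in> carrier M \<Longrightarrow> f (g b) = b"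
    and ab: "a \<lless>\<^bsub>M\<^esub> b"
  shows "g a \<lless>\<^bsub>L\<^esub> g b"
  unfolding way_below_def
proof (intro conjI allI impI)
  interpret L: complete_lattice L by fact
  interpret M: complete_lattice M by fact
  have carr: "a \<in> carrier M" "b \<in> carrier M" using ab way_below_carrier by metis+
  then show gab: "g a \<in> carrier L" "g b \<in> carrier L" using assms frame_hom_closed by metis+
  fix S assume S: "S \<subseteq> carrier L" "g b \<sqsubseteq>\<^bsub>L\<^esub> \<Squnion>\<^bsub>L\<^esub> S"
  have "b \<sqsubseteq>\<^bsub>M\<^esub> \<Squnion>\<^bsub>M\<^esub> (f ` S)"
    using frame_hom_mono[OF assms(1-3) _ _ S(2)] S gab fg carr frame_homD(4)[OF assms(3) S(1)] by simp
  moreover have "f ` S \<subseteq> carrier M" using S frame_hom_closed[OF assms(3)] by auto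
  ultimately obtain G where G: "finite G" "G \<subseteq> f ` S" "a \<sqsubseteq>\<^bsub>M\<^esub> \<Squnion>\<^bsub>M\<^esub> G"
    using way_belowE[OF ab] by metis
  obtain F where F: "finite F" "F \<subseteq> S" "G = f ` F" using G finite_subset_image by metis
  have Fc: "F \<subseteq> carrier L" using F S by auto
  have "a \<sqsubseteq>\<^bsub>M\<^esub> f (\<Squnion>\<^bsub>L\<^esub> F)" using G F frame_homD(4)[OF assms(3) Fc] by simp
  then have "g a \<sqsubseteq>\<^bsub>L\<^esub> g (f (\<Squnion>\<^bsub>L\<^esub> F))"
    using Fc carr frame_hom_closed[OF assms(3)]
    by (intro frame_hom_mono[OF assms(2,1,4)]) auto
  then show "\<exists>F. finite F \<and> F \<subseteq> S \<and> g a \<sqsubseteq>\<^bsub>L\<^esub> \<Squnion>\<^bsub>L\<^esub> F"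
    using F Fc gf by auto
qed

lemma pframe_hom_wb_pframe: "pframe_hom (wb_pframe K) (wb_pframe K') = proper_hom K K'"
  by (simp add: pframe_hom_def proper_hom_def frame_hom_def)

lemma pframe_hom_Rd: "pframe_hom (Rd L) (Rd M) = proper_hom (round_frame L) (round_frame M)"
  by (simp add: Rd_def pframe_hom_wb_pframe)

lemma Rd_map_apply:
  "is_round_ideal L I \<Longrightarrow> Rd_map L M f I = {a \<in> carrier M. \<exists>b\<in>I. a \<prec>\<^bsub>M\<^esub> f b}"
  by (simp add: Rd_map_def)

lemma Rd_map_mono:
  "\<lbrakk>is_round_ideal L I; is_round_ideal L J; I \<subseteq> J\<rbrakk> \<Longrightarrow> Rd_map L M f I \<subseteq> Rd_map L M f J"
  by (auto simp: Rd_map_apply)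

section \<open>The action of the functor on a morphism, and naturality of the counit\<close>

locale proximity_hom = L: proximity_frame L + M: proximity_frame M
  for L :: "('a, 'x) pframe_scheme" and M :: "('b, 'y) pframe_scheme" +
  fixes f :: "'a \<Rightarrow> 'b"
  assumes hom: "f \<in> pframe_hom L M"
begin

lemma frame_hom: "f \<in> frame_hom L M"
  using hom by (simp add: pframe_hom_def)

lemma closed: "a \<in> carrier L \<Longrightarrow> f a \<in> carrier M"
  using frame_hom by (rule frame_hom_closed)

lemma prox: "\<lbrakk>a \<in> carrier L; b \<in> carrier L; a \<prec>\<^bsub>L\<^esub> b\<rbrakk> \<Longrightarrow> f a \<prec>\<^bsub>M\<^esub> f b"
  using hom by (simp add: pframe_hom_def)

lemma mono: "\<lbrakk>a \<in> carrier L; b \<in> carrier L; a \<sqsubseteq>\<^bsub>L\<^esub> b\<rbrakk> \<Longrightarrow> f a \<sqsubseteq>\<^bsub>M\<^esub> f b"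
  by (rule frame_hom_mono[OF _ _ frame_hom]) unfold_locales

text \<open>Roundness gives \<open>c \<in> I\<close> above \<open>b\<close> in the proximity, and
  \<open>f\<close> preserves the proximity. Thus \<open>Rd_map L M f I\<close> contains the image of
  \<open>I\<close> although its definition asks for elements strictly related to that image.\<close>

lemma Rd_map_mem:
  assumes "is_round_ideal L I" "b \<in> I"
  shows "f b \<in> Rd_map L M f I"
proof -
  obtain c where c: "c \<in> I" "b \<prec>\<^bsub>L\<^esub> c" using assms by (meson round_idealE)
  then have "b \<in> carrier L" "c \<in> carrier L" using assms round_ideal_subset by blast+
  then show ?thesis using c assms prox closed by (auto simp: Rd_map_apply)
qed

lemma Rd_map_is_round:
  assumes "is_round_ideal L I"
  shows "is_round_ideal M (Rd_map L M f I)"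
  unfolding is_round_ideal_def
proof (intro conjI ballI)
  have Ic: "I \<subseteq> carrier L" using assms by (rule round_ideal_subset)
  then have fc: "f b \<in> carrier M" if "b \<in> I" for b using that closed by auto
  show "is_ideal M (Rd_map L M f I)"
  proof (rule M.is_idealI)
    show "Rd_map L M f I \<subseteq> carrier M" using assms by (auto simp: Rd_map_apply)
    show "b \<in> Rd_map L M f I" if ab: "a \<in> Rd_map L M f I" "b \<in> carrier M" "b \<sqsubseteq>\<^bsub>M\<^esub> a" for a b
    proof -
      obtain d where "d \<in> I" "a \<prec>\<^bsub>M\<^esub> f d" "a \<in> carrier M"
        using ab(1) assms by (auto simp: Rd_map_apply)
      then show ?thesis using ab(2,3) assms fc M.le_trans_prox[of b a "f d"] by (auto simp: Rd_map_apply)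
    qed
    show "\<bottom>\<^bsub>M\<^esub> \<in> Rd_map L M f I"
      using L.is_ideal_bottom[OF round_ideal_is_ideal[OF assms]] assms fc M.prox_bottom_left
      by (auto simp: Rd_map_apply)
    show "a \<squnion>\<^bsub>M\<^esub> b \<in> Rd_map L M f I" if ab: "a \<in> Rd_map L M f I" "b \<in> Rd_map L M f I" for a b
    proof -
      obtain a' b' where *: "a' \<in> I" "b' \<in> I" "a \<prec>\<^bsub>M\<^esub> f a'" "b \<prec>\<^bsub>M\<^esub> f b'"
        "a \<in> carrier M" "b \<in> carrier M"
        using ab assms by (auto simp: Rd_map_apply)
      have j: "a' \<squnion>\<^bsub>L\<^esub> b' \<in> I"
        using * assms by (meson L.is_ideal_join round_ideal_is_ideal)
      have c: "a' \<in> carrier L" "b' \<in> carrier L" "a' \<squnion>\<^bsub>L\<^esub> b' \<in> carrier L" using * j Ic by auto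
      \<comment> \<open>Both elements are compared with the image of one common member of
        \<open>I\<close>, after which \<open>prox_join_left\<close> applies.\<close>
      have "a \<prec>\<^bsub>M\<^esub> f (a' \<squnion>\<^bsub>L\<^esub> b')" "b \<prec>\<^bsub>M\<^esub> f (a' \<squnion>\<^bsub>L\<^esub> b')"
        using * c closed mono L.join_left L.join_right M.prox_trans_le by meson+
      then have "a \<squnion>\<^bsub>M\<^esub> b \<prec>\<^bsub>M\<^esub> f (a' \<squnion>\<^bsub>L\<^esub> b')" using * c closed by (intro M.prox_join_left)
      then show ?thesis using * j assms by (auto simp: Rd_map_apply)
    qed
  qed
  fix a assume "a \<in> Rd_map L M f I"
  then obtain b where b: "b \<in> I" "a \<prec>\<^bsub>M\<^esub> f b" "a \<in> carrier M"
    using assms by (auto simp: Rd_map_apply)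
  then show "\<exists>c\<in>Rd_map L M f I. a \<prec>\<^bsub>M\<^esub> c" using Rd_map_mem assms by blast
qed

lemma Rd_map_frame_hom: "Rd_map L M f \<in> frame_hom (round_frame L) (round_frame M)"
  unfolding frame_hom_def
proof (intro CollectI conjI ballI allI impI)
  show "Rd_map L M f \<in> carrier (round_frame L) \<rightarrow>\<^sub>E carrier (round_frame M)"
    using Rd_map_is_round by (auto simp: Rd_map_def)
  show "Rd_map L M f \<top>\<^bsub>round_frame L\<^esub> = \<top>\<^bsub>round_frame M\<^esub>"
    using M.prox_top_right frame_homD(2)[OF frame_hom]
    by (auto simp: L.round_frame_top M.round_frame_top Rd_map_apply L.round_ideal_carrier
        intro!: bexI[of _ "\<top>\<^bsub>L\<^esub>"])
next
  fix I J assume "I \<in> carrier (round_frame L)" "J \<in> carrier (round_frame L)"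
  then have r: "is_round_ideal L I" "is_round_ideal L J" by auto
  have "a \<in> Rd_map L M f (I \<inter> J)" if a: "a \<in> Rd_map L M f I" "a \<in> Rd_map L M f J" for a
  proof -
    obtain b c where bc: "b \<in> I" "c \<in> J" "a \<prec>\<^bsub>M\<^esub> f b" "a \<prec>\<^bsub>M\<^esub> f c" "a \<in> carrier M"
      using a r by (auto simp: Rd_map_apply)
    have c: "b \<in> carrier L" "c \<in> carrier L" using bc r round_ideal_subset by blast+
    have "a \<prec>\<^bsub>M\<^esub> f (b \<sqinter>\<^bsub>L\<^esub> c)"
      using bc c closed M.prox_meet_right frame_homD(3)[OF frame_hom] by simp
    moreover have "b \<sqinter>\<^bsub>L\<^esub> c \<in> I" "b \<sqinter>\<^bsub>L\<^esub> c \<in> J"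
      using bc c r by (auto intro: round_ideal_down L.meet_left L.meet_right)
    ultimately show ?thesis using bc r by (auto simp: Rd_map_apply L.round_ideal_Int)
  qed
  moreover have "Rd_map L M f (I \<inter> J) \<subseteq> Rd_map L M f I" "Rd_map L M f (I \<inter> J) \<subseteq> Rd_map L M f J"
    using r L.round_ideal_Int by (simp_all add: Rd_map_mono)
  ultimately have "Rd_map L M f (I \<inter> J) = Rd_map L M f I \<inter> Rd_map L M f J" by blast
  then show "Rd_map L M f (I \<sqinter>\<^bsub>round_frame L\<^esub> J) =
      Rd_map L M f I \<sqinter>\<^bsub>round_frame M\<^esub> Rd_map L M f J"
    using r by (simp add: L.round_frame_meet M.round_frame_meet Rd_map_is_round)
next
  fix S assume "S \<subseteq> carrier (round_frame L)"
  then have S: "S \<subseteq> Collect (is_round_ideal L)" by simp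
  have RS: "Rd_map L M f ` S \<subseteq> Collect (is_round_ideal M)" using S Rd_map_is_round by auto
  have carr: "\<Union>S \<subseteq> carrier L" using S round_ideal_subset by fastforce
  have sp: "is_round_ideal L (ideal_span L S)" "is_round_ideal M (ideal_span M (Rd_map L M f ` S))"
    using S RS L.ideal_span_is_round M.ideal_span_is_round by auto
  have "Rd_map L M f (ideal_span L S) = ideal_span M (Rd_map L M f ` S)"
  proof
    show "ideal_span M (Rd_map L M f ` S) \<subseteq> Rd_map L M f (ideal_span L S)"
    proof (rule ideal_span_least)
      show "is_ideal M (Rd_map L M f (ideal_span L S))"
        using Rd_map_is_round sp round_ideal_is_ideal by blast
      fix J assume "J \<in> Rd_map L M f ` S"
      then obtain I where I: "I \<in> S" "J = Rd_map L M f I" by auto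
      then have "I \<subseteq> ideal_span L S" using carr by (intro L.ideal_span_upper) auto
      then show "J \<subseteq> Rd_map L M f (ideal_span L S)"
        using I S sp Rd_map_mono[of L I "ideal_span L S" M f] by auto
    qed
    show "Rd_map L M f (ideal_span L S) \<subseteq> ideal_span M (Rd_map L M f ` S)"
    proof
      fix a assume "a \<in> Rd_map L M f (ideal_span L S)"
      then obtain b where b: "b \<in> ideal_span L S" "a \<prec>\<^bsub>M\<^esub> f b" "a \<in> carrier M"
        using sp by (auto simp: Rd_map_apply)
      then obtain F where F: "finite F" "F \<subseteq> \<Union>S" "b \<sqsubseteq>\<^bsub>L\<^esub> \<Squnion>\<^bsub>L\<^esub> F" "b \<in> carrier L"
        by (auto simp: ideal_span_def)
      have Fc: "F \<subseteq> carrier L" using F carr by auto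
      \<comment> \<open>Weakening \<open>a \<prec> f b\<close> to the order is harmless here: the
        images of the members of \<open>F\<close> already lie in the ideals being joined, by
        \<open>Rd_map_mem\<close>, and the span is defined through the order.\<close>
      have "f b \<sqsubseteq>\<^bsub>M\<^esub> f (\<Squnion>\<^bsub>L\<^esub> F)" using F Fc mono by auto
      moreover have "a \<sqsubseteq>\<^bsub>M\<^esub> f b" using b F closed M.prox_le by auto
      moreover have "f b \<in> carrier M" "f (\<Squnion>\<^bsub>L\<^esub> F) \<in> carrier M" using F Fc closed by auto
      ultimately have "a \<sqsubseteq>\<^bsub>M\<^esub> f (\<Squnion>\<^bsub>L\<^esub> F)" using b by (meson M.le_trans)
      then have "a \<sqsubseteq>\<^bsub>M\<^esub> \<Squnion>\<^bsub>M\<^esub> (f ` F)" using frame_homD(4)[OF frame_hom Fc] by simp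
      moreover have "f ` F \<subseteq> \<Union>(Rd_map L M f ` S)" using F S Rd_map_mem by blast
      ultimately show "a \<in> ideal_span M (Rd_map L M f ` S)"
        using F b unfolding ideal_span_def by blast
    qed
  qed
  then show "Rd_map L M f (\<Squnion>\<^bsub>round_frame L\<^esub> S) = \<Squnion>\<^bsub>round_frame M\<^esub> (Rd_map L M f ` S)"
    using S RS by (simp add: L.round_frame_sup M.round_frame_sup)
qed

text \<open>A member \<open>b\<close> of \<open>J\<close> bounding \<open>I\<close> yields
  \<open>f b\<close>, which bounds \<open>Rd_map L M f I\<close> by monotonicity and belongs to
  \<open>Rd_map L M f J\<close> by \<open>Rd_map_mem\<close>.\<close>

lemma Rd_map_proper_hom: "Rd_map L M f \<in> proper_hom (round_frame L) (round_frame M)"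
  unfolding proper_hom_def
proof (intro CollectI conjI ballI impI Rd_map_frame_hom)
  fix I J assume "I \<lless>\<^bsub>round_frame L\<^esub> J"
  then obtain b where r: "is_round_ideal L I" "is_round_ideal L J"
    and b: "b \<in> J" "\<And>a. a \<in> I \<Longrightarrow> a \<sqsubseteq>\<^bsub>L\<^esub> b" by (auto simp: L.round_way_below_iff)
  have c: "b \<in> carrier L" "I \<subseteq> carrier L" using b r round_ideal_subset by blast+
  have "a \<sqsubseteq>\<^bsub>M\<^esub> f b" if a: "a \<in> Rd_map L M f I" for a
  proof -
    obtain d where d: "d \<in> I" "a \<prec>\<^bsub>M\<^esub> f d" "a \<in> carrier M"
      using a r by (auto simp: Rd_map_apply)
    have "d \<in> carrier L" using d c by auto
    then have "a \<sqsubseteq>\<^bsub>M\<^esub> f d" "f d \<sqsubseteq>\<^bsub>M\<^esub> f b" "f d \<in> carrier M" "f b \<in> carrier M"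
      using d c b mono closed M.prox_le by auto
    then show ?thesis using d by (meson M.le_trans)
  qed
  then show "Rd_map L M f I \<lless>\<^bsub>round_frame M\<^esub> Rd_map L M f J"
    using r b(1) Rd_map_mem[of J b] Rd_map_is_round by (auto simp: M.round_way_below_iff)
qed

lemma Rd_map_pframe_hom: "Rd_map L M f \<in> pframe_hom (Rd L) (Rd M)"
  by (simp add: pframe_hom_Rd Rd_map_proper_hom)

lemma sup_Rd_map:
  assumes "is_round_ideal L I"
  shows "\<Squnion>\<^bsub>M\<^esub> (Rd_map L M f I) = f (\<Squnion>\<^bsub>L\<^esub> I)"
proof -
  have c: "I \<subseteq> carrier L" using assms by (rule round_ideal_subset)
  have fc: "f ` I \<subseteq> carrier M" using c closed by auto
  have Rc: "Rd_map L M f I \<subseteq> carrier M" using assms Rd_map_is_round round_ideal_subset by metis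
  have "\<Squnion>\<^bsub>M\<^esub> (Rd_map L M f I) = \<Squnion>\<^bsub>M\<^esub> (f ` I)"
  proof (rule M.le_antisym)
    show "\<Squnion>\<^bsub>M\<^esub> (f ` I) \<sqsubseteq>\<^bsub>M\<^esub> \<Squnion>\<^bsub>M\<^esub> (Rd_map L M f I)"
      using assms Rd_map_mem Rc by (intro M.sup_mono) auto
    show "\<Squnion>\<^bsub>M\<^esub> (Rd_map L M f I) \<sqsubseteq>\<^bsub>M\<^esub> \<Squnion>\<^bsub>M\<^esub> (f ` I)"
    proof (rule M.weak.sup_least[OF Rc])
      fix a assume "a \<in> Rd_map L M f I"
      then obtain b where b: "b \<in> I" "a \<prec>\<^bsub>M\<^esub> f b" "a \<in> carrier M"
        using assms by (auto simp: Rd_map_apply)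
      have "a \<sqsubseteq>\<^bsub>M\<^esub> f b" "f b \<sqsubseteq>\<^bsub>M\<^esub> \<Squnion>\<^bsub>M\<^esub> (f ` I)" "f b \<in> carrier M"
        using b fc by (auto intro: M.prox_le M.weak.sup_upper)
      then show "a \<sqsubseteq>\<^bsub>M\<^esub> \<Squnion>\<^bsub>M\<^esub> (f ` I)" using b fc by (meson M.le_trans M.weak.sup_closed)
    qed (use fc in auto)
  qed (use Rc fc in auto)
  then show ?thesis using frame_homD(4)[OF frame_hom c] by simp
qed

lemma sigma_natural:
  "compose (carrier (Rd L)) (sigma M) (Rd_map L M f) = compose (carrier (Rd L)) f (sigma L)"
  unfolding compose_def
  by (intro restrict_ext) (simp add: sigma_def Rd_map_is_round sup_Rd_map)

end

lemma proximity_homI: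
  "\<lbrakk>proximity_frame L; proximity_frame M; f \<in> pframe_hom L M\<rbrakk> \<Longrightarrow> proximity_hom L M f"
  by (simp add: proximity_hom_def proximity_hom_axioms_def)

lemma (in proximity_frame) Rd_map_id:
  "Rd_map L L (\<lambda>x\<in>carrier L. x) = (\<lambda>I\<in>carrier (Rd L). I)"
  unfolding Rd_map_def
proof (rule restrict_ext)
  fix I assume "I \<in> carrier (Rd L)"
  then have I: "is_round_ideal L I" by simp
  then have c: "I \<subseteq> carrier L" by (rule round_ideal_subset)
  then have "{a \<in> carrier L. \<exists>b\<in>I. a \<prec> (\<lambda>x\<in>carrier L. x) b} = {a \<in> carrier L. \<exists>b\<in>I. a \<prec> b}"
    by (intro Collect_cong conj_cong refl bex_cong) auto
  also have "\<dots> = I"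
  proof
    show "{a \<in> carrier L. \<exists>b\<in>I. a \<prec> b} \<subseteq> I"
      using I c by (auto intro: round_ideal_down prox_le)
    show "I \<subseteq> {a \<in> carrier L. \<exists>b\<in>I. a \<prec> b}"
      using I c by (auto simp: is_round_ideal_def)
  qed
  finally show "{a \<in> carrier L. \<exists>b\<in>I. a \<prec> (\<lambda>x\<in>carrier L. x) b} = I" .
qed

text \<open>One direction takes \<open>f b\<close> itself as the intermediate element, which is
  available by \<open>Rd_map_mem\<close>. The other absorbs an intermediate
  \<open>c \<prec> f b\<close> through monotonicity of \<open>g\<close>.\<close>

lemma Rd_map_compose:
  assumes "proximity_hom L M f" "proximity_hom M N g"
  shows "Rd_map L N (compose (carrier L) g f) =
    compose (carrier (Rd L)) (Rd_map M N g) (Rd_map L M f)"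
proof -
  interpret f: proximity_hom L M f by fact
  interpret g: proximity_hom M N g by fact
  show ?thesis
    unfolding compose_def[of "carrier (Rd L)"] unfolding Rd_map_def[of L N]
  proof (rule restrict_ext)
    fix I assume "I \<in> carrier (Rd L)"
    then have I: "is_round_ideal L I" by simp
    have c: "I \<subseteq> carrier L" using I by (rule round_ideal_subset)
    have "(\<exists>b\<in>I. a \<prec>\<^bsub>N\<^esub> g (f b)) \<longleftrightarrow> (\<exists>c\<in>Rd_map L M f I. a \<prec>\<^bsub>N\<^esub> g c)"
      if a: "a \<in> carrier N" for a
    proof
      assume "\<exists>b\<in>I. a \<prec>\<^bsub>N\<^esub> g (f b)"
      then show "\<exists>c\<in>Rd_map L M f I. a \<prec>\<^bsub>N\<^esub> g c" using f.Rd_map_mem[OF I] by blast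
    next
      assume "\<exists>c\<in>Rd_map L M f I. a \<prec>\<^bsub>N\<^esub> g c"
      then obtain c b where cb: "a \<prec>\<^bsub>N\<^esub> g c" "c \<in> carrier M" "b \<in> I" "c \<prec>\<^bsub>M\<^esub> f b"
        using I by (auto simp: Rd_map_apply)
      have "f b \<in> carrier M" using cb \<open>I \<subseteq> carrier L\<close> f.closed by auto
      then have "g c \<sqsubseteq>\<^bsub>N\<^esub> g (f b)" "g c \<in> carrier N" "g (f b) \<in> carrier N"
        using cb g.mono g.closed f.M.prox_le by auto
      then have "a \<prec>\<^bsub>N\<^esub> g (f b)" using a cb g.M.prox_trans_le by blast
      then show "\<exists>b\<in>I. a \<prec>\<^bsub>N\<^esub> g (f b)" using cb by blast
    qed
    moreover have "compose (carrier L) g f b = g (f b)" if "b \<in> I" for b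
      using that c by (auto simp: compose_def)
    ultimately show "{a \<in> carrier N. \<exists>b\<in>I. a \<prec>\<^bsub>N\<^esub> compose (carrier L) g f b} =
        Rd_map M N g (Rd_map L M f I)"
      using f.Rd_map_is_round[OF I] by (auto simp: Rd_map_apply)
  qed
qed

section \<open>Counit and comultiplication\<close>

context proximity_frame
begin

lemma sigma_apply: "is_round_ideal L I \<Longrightarrow> sigma L I = \<Squnion>I"
  by (simp add: sigma_def)

lemma sigma_closed: "is_round_ideal L I \<Longrightarrow> sigma L I \<in> carrier L"
  by (simp add: sigma_apply round_ideal_subset)

text \<open>This is the approximation axiom of the proximity.\<close>

lemma sigma_kappa: "a \<in> carrier L \<Longrightarrow> sigma L (kappa L a) = a"
  using kappa_is_round[of a] prox_approx[of a] by (simp add: sigma_apply kappa_apply)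

lemma sigma_pframe_hom: "sigma L \<in> pframe_hom (Rd L) L"
  unfolding pframe_hom_def frame_hom_def
proof (intro CollectI conjI ballI allI impI)
  show "sigma L \<in> carrier (Rd L) \<rightarrow>\<^sub>E carrier L"
    by (auto simp: sigma_def round_ideal_subset)
  have "\<top> = \<Squnion>(carrier L)" by (rule top_eqI) (auto intro: weak.sup_upper)
  then show "sigma L \<top>\<^bsub>Rd L\<^esub> = \<top>" by (simp add: round_frame_top sigma_apply round_ideal_carrier)
next
  fix I J assume "I \<in> carrier (Rd L)" "J \<in> carrier (Rd L)"
  then have r: "is_round_ideal L I" "is_round_ideal L J" by auto
  then have c: "I \<subseteq> carrier L" "J \<subseteq> carrier L" using round_ideal_subset by auto
  \<comment> \<open>The frame law is used once in each argument; the meets of members that result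
    lie in both ideals.\<close>
  have "\<Squnion>I \<sqinter> \<Squnion>J \<sqsubseteq> \<Squnion>(I \<inter> J)"
  proof -
    have s: "\<Squnion>I \<in> carrier L" "\<Squnion>J \<in> carrier L" "\<Squnion>(I \<inter> J) \<in> carrier L"
      using c by (auto intro!: weak.sup_closed)
    have "a \<sqinter> \<Squnion>J \<sqsubseteq> \<Squnion>(I \<inter> J)" if "a \<in> I" for a
    proof -
      have a: "a \<in> carrier L" using that c by auto
      have "a \<sqinter> b \<in> I \<inter> J" if "b \<in> J" for b
      proof -
        have "b \<in> carrier L" using that c by auto
        then show ?thesis using r a \<open>a \<in> I\<close> that
          by (auto intro: round_ideal_down meet_left meet_right)
      qed
      then have "\<Squnion>((\<lambda>b. a \<sqinter> b) ` J) \<sqsubseteq> \<Squnion>(I \<inter> J)" using c by (intro sup_mono) auto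
      then show ?thesis using a c by (simp add: inf_Sup_distrib)
    qed
    then have "\<Squnion>((\<lambda>a. \<Squnion>J \<sqinter> a) ` I) \<sqsubseteq> \<Squnion>(I \<inter> J)"
      using s c by (intro weak.sup_least) (auto simp: meet_comm[of L "\<Squnion>J"])
    then show ?thesis using s c by (simp add: inf_Sup_distrib meet_comm[of L "\<Squnion>I"])
  qed
  moreover have "\<Squnion>(I \<inter> J) \<sqsubseteq> \<Squnion>I \<sqinter> \<Squnion>J"
    using c by (intro meet_le sup_mono weak.sup_closed) auto
  ultimately have "\<Squnion>(I \<inter> J) = \<Squnion>I \<sqinter> \<Squnion>J"
    using c by (intro le_antisym) (auto intro!: weak.sup_closed meet_closed)
  then show "sigma L (I \<sqinter>\<^bsub>Rd L\<^esub> J) = sigma L I \<sqinter> sigma L J"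
    using r by (simp add: round_frame_meet sigma_apply round_ideal_Int)
next
  fix S assume "S \<subseteq> carrier (Rd L)"
  then have S: "S \<subseteq> Collect (is_round_ideal L)" by simp
  have c: "\<Union>S \<subseteq> carrier L" using S round_ideal_subset by fastforce
  have sc: "sigma L ` S \<subseteq> carrier L" using S sigma_closed by auto
  have "\<Squnion>(\<Union>S) = \<Squnion>(sigma L ` S)"
  proof (rule sup_eqI[OF c])
    show "x \<sqsubseteq> \<Squnion>(sigma L ` S)" if x: "x \<in> \<Union>S" for x
    proof -
      obtain I where I: "I \<in> S" "x \<in> I" using x by auto
      then have Ic: "I \<subseteq> carrier L" "is_round_ideal L I" using c S by auto
      have "x \<sqsubseteq> \<Squnion>I" using I Ic by (auto intro: weak.sup_upper)
      moreover have "\<Squnion>I \<sqsubseteq> \<Squnion>(sigma L ` S)"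
        using I Ic sc by (intro weak.sup_upper) (auto simp: sigma_apply intro!: image_eqI[of _ _ I])
      ultimately show ?thesis using I Ic sc by (meson le_trans subsetD weak.sup_closed)
    qed
    show "\<Squnion>(sigma L ` S) \<sqsubseteq> u" if u: "u \<in> carrier L" "\<And>x. x \<in> \<Union>S \<Longrightarrow> x \<sqsubseteq> u" for u
    proof (rule weak.sup_least[OF sc u(1)])
      fix y assume "y \<in> sigma L ` S"
      then obtain I where I: "I \<in> S" "y = \<Squnion>I" using S by (auto simp: sigma_apply subset_iff)
      then have "I \<subseteq> carrier L" using c by auto
      then show "y \<sqsubseteq> u" using I u(1) by (simp, intro weak.sup_least) (auto intro!: u(2))
    qed
  qed (use sc in auto)
  then show "sigma L (\<Squnion>\<^bsub>Rd L\<^esub> S) = \<Squnion>(sigma L ` S)"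
    using S c by (simp add: round_frame_sup sigma_apply ideal_span_is_round sup_ideal_span)
next
  fix I J assume "I \<prec>\<^bsub>Rd L\<^esub> J"
  then obtain b where r: "is_round_ideal L I" "is_round_ideal L J"
    and b: "b \<in> J" "\<And>a. a \<in> I \<Longrightarrow> a \<sqsubseteq> b" by (auto simp: round_way_below_iff)
  \<comment> \<open>Roundness lifts the bound inside \<open>J\<close>, giving the chain
    \<open>\<Squnion>I \<sqsubseteq> b \<prec> d \<sqsubseteq> \<Squnion>J\<close>.\<close>
  obtain d where d: "d \<in> J" "b \<prec> d" using b r by (meson round_idealE)
  have c: "I \<subseteq> carrier L" "J \<subseteq> carrier L" "b \<in> carrier L" "d \<in> carrier L"
    using b d r round_ideal_subset by blast+
  have "\<Squnion>I \<sqsubseteq> b" "d \<sqsubseteq> \<Squnion>J" using b d c by (auto intro: weak.sup_least weak.sup_upper)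
  then show "sigma L I \<prec> sigma L J"
    using prox_le_trans[of "\<Squnion>I" b d "\<Squnion>J"] c d r by (simp add: sigma_apply)
qed

end

text \<open>If \<open>b\<close> is way below the join of \<open>I\<close>, then it lies below one
  member of \<open>I\<close>, since ideals are closed under finite joins. Conversely, roundness puts
  a member of \<open>I\<close> way below another member, hence way below the join.\<close>

lemma stably_compact_kappa_sigma:
  assumes "stably_compact_frame K" "is_round_ideal (wb_pframe K) I"
  shows "kappa (wb_pframe K) (sigma (wb_pframe K) I) = I"
proof -
  interpret stably_compact_frame K by fact
  interpret W: proximity_frame "wb_pframe K" by (rule wb_pframe_proximity_frame) fact
  have c: "I \<subseteq> carrier K" using round_ideal_subset[OF assms(2)] by simp
  have id: "is_ideal (wb_pframe K) I" using assms(2) by (rule round_ideal_is_ideal)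
  have "b \<in> I" if "b \<lless>\<^bsub>K\<^esub> \<Squnion>\<^bsub>K\<^esub> I" for b
  proof -
    obtain d where "d \<in> I" "b \<sqsubseteq>\<^bsub>K\<^esub> d"
      using way_below_mem[of b "\<Squnion>\<^bsub>K\<^esub> I" I] \<open>b \<lless>\<^bsub>K\<^esub> _\<close> c
        W.is_ideal_bottom[OF id] W.is_ideal_join[OF id] by auto
    then show ?thesis using is_ideal_down[OF id] way_below_carrier[OF that] by auto
  qed
  moreover have "b \<lless>\<^bsub>K\<^esub> \<Squnion>\<^bsub>K\<^esub> I" if b: "b \<in> I" for b
  proof -
    obtain d where d: "d \<in> I" "b \<lless>\<^bsub>K\<^esub> d" using round_idealE[OF assms(2) b] by auto
    then have "d \<sqsubseteq>\<^bsub>K\<^esub> \<Squnion>\<^bsub>K\<^esub> I" using c by (intro weak.sup_upper)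
    then show ?thesis using c b d way_below_trans[of b "\<Squnion>\<^bsub>K\<^esub> I" b d] by auto
  qed
  ultimately show ?thesis
    using c W.sigma_closed[OF assms(2)] assms(2) by (auto simp: W.kappa_apply W.sigma_apply)
qed

lemma stably_compact_kappa_hom:
  assumes "stably_compact_frame K"
  shows "kappa (wb_pframe K) \<in> pframe_hom (wb_pframe K) (Rd (wb_pframe K))"
proof -
  interpret W: proximity_frame "wb_pframe K" by (rule wb_pframe_proximity_frame) fact
  interpret R: proximity_frame "Rd (wb_pframe K)" by (rule W.Rd_proximity_frame)
  note cl = R.complete_lattice_axioms W.complete_lattice_axioms
  have s: "sigma (wb_pframe K) \<in> frame_hom (Rd (wb_pframe K)) (wb_pframe K)"
    using W.sigma_pframe_hom by (simp add: pframe_hom_def)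
  have k: "kappa (wb_pframe K) \<in> carrier (wb_pframe K) \<rightarrow>\<^sub>E carrier (Rd (wb_pframe K))"
    using W.kappa_is_round by (auto simp: kappa_def[of "wb_pframe K"])
  have inv: "kappa (wb_pframe K) (sigma (wb_pframe K) I) = I" if "I \<in> carrier (Rd (wb_pframe K))" for I
    using that stably_compact_kappa_sigma[OF assms] by simp
  have f: "kappa (wb_pframe K) \<in> frame_hom (wb_pframe K) (Rd (wb_pframe K))"
    by (rule frame_hom_inverse[OF cl(1) s k inv W.sigma_kappa])
  moreover have "kappa (wb_pframe K) a \<prec>\<^bsub>Rd (wb_pframe K)\<^esub> kappa (wb_pframe K) b"
    if "a \<prec>\<^bsub>wb_pframe K\<^esub> b" for a b
    using frame_hom_inverse_way_below[OF cl s f inv W.sigma_kappa, of a b] that by simp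
  ultimately show ?thesis by (auto simp: pframe_hom_def)
qed

section \<open>The comonad laws and idempotence\<close>

context proximity_frame
begin

text \<open>An ideal way below some \<open>kappa L b\<close> with \<open>b \<in> I\<close> is way
  below \<open>I\<close> because \<open>kappa L b \<subseteq> I\<close>. Conversely, the element of
  \<open>I\<close> that bounds \<open>J\<close> lies in \<open>kappa L d\<close> for some
  \<open>d \<in> I\<close>, so it also witnesses \<open>J \<lless> kappa L d\<close>.\<close>

lemma comult_eq_kappa: "comult L = kappa (Rd L)"
  unfolding comult_def Rd_map_def kappa_def[of "Rd L"]
proof (intro restrict_ext Collect_cong conj_cong)
  interpret R: frame "round_frame L" by (rule round_frame_frame)
  fix I J assume "I \<in> carrier (Rd L)" "J \<in> carrier (Rd L)"
  then have r: "is_round_ideal L I" "is_round_ideal L J" by auto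
  have c: "I \<subseteq> carrier L" using r round_ideal_subset by auto
  show "(\<exists>b\<in>I. J \<prec>\<^bsub>Rd L\<^esub> kappa L b) \<longleftrightarrow> J \<prec>\<^bsub>Rd L\<^esub> I"
  proof
    assume "\<exists>b\<in>I. J \<prec>\<^bsub>Rd L\<^esub> kappa L b"
    then show "J \<prec>\<^bsub>Rd L\<^esub> I"
      using R.way_below_trans[of J I J] kappa_subset r by auto
  next
    assume "J \<prec>\<^bsub>Rd L\<^esub> I"
    then obtain b where b: "b \<in> I" "\<And>a. a \<in> J \<Longrightarrow> a \<sqsubseteq> b" by (auto simp: round_way_below_iff)
    obtain d where d: "d \<in> I" "b \<prec> d" using b r by (meson round_idealE)
    have "b \<in> carrier L" "d \<in> carrier L" using b d c by auto
    then have "b \<in> kappa L d" using d by (simp add: kappa_apply)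
    then have "J \<prec>\<^bsub>Rd L\<^esub> kappa L d"
      using b r kappa_is_round \<open>d \<in> carrier L\<close> by (auto simp: round_way_below_iff)
    then show "\<exists>b\<in>I. J \<prec>\<^bsub>Rd L\<^esub> kappa L b" using d by auto
  qed
qed auto

lemma comult_pframe_hom: "comult L \<in> pframe_hom (Rd L) (Rd (Rd L))"
  using stably_compact_kappa_hom[OF round_frame_stably_compact]
  by (simp add: comult_eq_kappa Rd_def)

lemma sigma_comult:
  "compose (carrier (Rd L)) (sigma (Rd L)) (comult L) = (\<lambda>I\<in>carrier (Rd L). I)"
  unfolding compose_def comult_eq_kappa
  by (intro restrict_ext proximity_frame.sigma_kappa Rd_proximity_frame)

lemma comult_sigma:
  "compose (carrier (Rd (Rd L))) (comult L) (sigma (Rd L)) = (\<lambda>I\<in>carrier (Rd (Rd L)). I)"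
  unfolding compose_def comult_eq_kappa
  using stably_compact_kappa_sigma[OF round_frame_stably_compact]
  by (intro restrict_ext) (simp flip: Rd_def)

lemma comult_pframe_iso: "comult L \<in> pframe_iso (Rd L) (Rd (Rd L))"
  unfolding pframe_iso_def
  using comult_pframe_hom sigma_comult comult_sigma
    proximity_frame.sigma_pframe_hom[OF Rd_proximity_frame] by blast

lemma Rd_map_sigma_comult:
  "compose (carrier (Rd L)) (Rd_map (Rd L) L (sigma L)) (comult L) = (\<lambda>I\<in>carrier (Rd L). I)"
  unfolding compose_def
proof (rule restrict_ext)
  interpret R: proximity_frame "Rd L" by (rule Rd_proximity_frame)
  fix I assume I': "I \<in> carrier (Rd L)"
  then have I: "is_round_ideal L I" by simp
  have c: "I \<subseteq> carrier L" using I by (rule round_ideal_subset)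
  have eq: "Rd_map (Rd L) L (sigma L) (comult L I) =
    {a \<in> carrier L. \<exists>J. J \<lless>\<^bsub>round_frame L\<^esub> I \<and> a \<prec> sigma L J}"
    using R.kappa_is_round[OF I'] I'
    by (auto simp: comult_eq_kappa Rd_map_apply R.kappa_apply round_way_below_iff)
  have "a \<in> I" if a: "a \<in> carrier L" "J \<lless>\<^bsub>round_frame L\<^esub> I" "a \<prec> sigma L J" for a J
  \<comment> \<open>A bound \<open>b \<in> I\<close> of \<open>J\<close> also bounds its join, so
    \<open>a \<prec> sigma L J\<close> yields \<open>a \<prec> b\<close> and hence
    \<open>a \<in> I\<close>.\<close>
  proof -
    obtain b where b: "b \<in> I" "\<And>x. x \<in> J \<Longrightarrow> x \<sqsubseteq> b" "is_round_ideal L J"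
      using a by (auto simp: round_way_below_iff)
    have bc: "b \<in> carrier L" using b c by auto
    have "\<Squnion>J \<sqsubseteq> b" using b bc round_ideal_subset[OF b(3)] by (intro weak.sup_least)
    moreover have "\<Squnion>J \<in> carrier L" using round_ideal_subset[OF b(3)] by auto
    ultimately have "a \<prec> b" using prox_trans_le[of a "\<Squnion>J" b] a b bc by (simp add: sigma_apply)
    then show ?thesis using I a b bc by (meson prox_le round_ideal_down)
  qed
  moreover have "\<exists>J. J \<lless>\<^bsub>round_frame L\<^esub> I \<and> a \<prec> sigma L J" if a: "a \<in> I" for a
  proof -
    \<comment> \<open>The witness is \<open>J = kappa L b\<close>: it is way below \<open>I\<close>
      and its join is exactly \<open>b\<close>.\<close>
    obtain b where b: "b \<in> I" "a \<prec> b" using a I by (meson round_idealE)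
    then have "kappa L b \<lless>\<^bsub>round_frame L\<^esub> I" "sigma L (kappa L b) = b"
      using kappa_way_below I c sigma_kappa by auto
    then show ?thesis using b by auto
  qed
  ultimately show "Rd_map (Rd L) L (sigma L) (comult L I) = I" unfolding eq using c by blast
qed

text \<open>After \<open>comult L\<close> is rewritten as \<open>kappa (Rd L)\<close>, the left
  outer map is literally the definition of \<open>comult (Rd L)\<close>.\<close>

lemma comult_coassoc:
  "compose (carrier (Rd L)) (Rd_map (Rd L) (Rd (Rd L)) (comult L)) (comult L) =
    compose (carrier (Rd L)) (comult (Rd L)) (comult L)"
  by (simp add: comult_eq_kappa comult_def[of "Rd L"])

end

lemma (in proximity_hom) comult_natural:
  "compose (carrier (Rd L)) (comult M) (Rd_map L M f) =
    compose (carrier (Rd L)) (Rd_map (Rd L) (Rd M) (Rd_map L M f)) (comult L)"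
  unfolding compose_def
proof (rule restrict_ext)
  interpret RL: proximity_frame "Rd L" by (rule L.Rd_proximity_frame)
  interpret RM: proximity_frame "Rd M" by (rule M.Rd_proximity_frame)
  interpret FM: frame "round_frame M" by (rule M.round_frame_frame)
  fix I assume I': "I \<in> carrier (Rd L)"
  then have I: "is_round_ideal L I" by simp
  have c: "I \<subseteq> carrier L" using I by (rule round_ideal_subset)
  have lhs: "comult M (Rd_map L M f I) = {J. J \<lless>\<^bsub>round_frame M\<^esub> Rd_map L M f I}"
    using Rd_map_is_round[OF I] by (auto simp: M.comult_eq_kappa RM.kappa_apply dest: way_below_carrier)
  have rhs: "Rd_map (Rd L) (Rd M) (Rd_map L M f) (comult L I) =
    {J. \<exists>H. H \<lless>\<^bsub>round_frame L\<^esub> I \<and> J \<lless>\<^bsub>round_frame M\<^esub> Rd_map L M f H}"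
    using RL.kappa_is_round[OF I'] I'
    by (auto simp: L.comult_eq_kappa Rd_map_apply[of "Rd L"] RL.kappa_apply
        L.round_way_below_iff M.round_way_below_iff)
  have "J \<lless>\<^bsub>round_frame M\<^esub> Rd_map L M f I"
    if H: "H \<lless>\<^bsub>round_frame L\<^esub> I" "J \<lless>\<^bsub>round_frame M\<^esub> Rd_map L M f H" for H J
  proof -
    have "is_round_ideal L H" "H \<subseteq> I"
      using H complete_lattice.way_below_le[OF L.round_frame_complete_lattice] way_below_carrier
      by fastforce+
    then have "Rd_map L M f H \<subseteq> Rd_map L M f I" using I by (intro Rd_map_mono)
    then show ?thesis using FM.way_below_trans[of J _ J] H Rd_map_is_round I way_below_carrier
      by fastforce
  qed
  moreover have "\<exists>H. H \<lless>\<^bsub>round_frame L\<^esub> I \<and> J \<lless>\<^bsub>round_frame M\<^esub> Rd_map L M f H"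
    if J: "J \<lless>\<^bsub>round_frame M\<^esub> Rd_map L M f I" for J
  proof -
    obtain a where a: "a \<in> Rd_map L M f I" "\<And>x. x \<in> J \<Longrightarrow> x \<sqsubseteq>\<^bsub>M\<^esub> a" "is_round_ideal M J"
      using J by (auto simp: M.round_way_below_iff)
    obtain b where b: "b \<in> I" "a \<prec>\<^bsub>M\<^esub> f b" "a \<in> carrier M"
      using a I by (auto simp: Rd_map_apply)
    \<comment> \<open>The witness will be \<open>H = kappa L d\<close>. Roundness makes
      \<open>b\<close> a member of it, so the bound \<open>a\<close> of \<open>J\<close> survives in
      \<open>Rd_map L M f H\<close>.\<close>
    obtain d where d: "d \<in> I" "b \<prec>\<^bsub>L\<^esub> d" using b I by (meson round_idealE)
    have bd: "b \<in> carrier L" "d \<in> carrier L" using b d c by auto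
    have k: "is_round_ideal L (kappa L d)" "b \<in> kappa L d"
      using bd d L.kappa_is_round by (auto simp: L.kappa_apply)
    then have "a \<in> Rd_map L M f (kappa L d)" using b by (auto simp: Rd_map_apply)
    then have "J \<lless>\<^bsub>round_frame M\<^esub> Rd_map L M f (kappa L d)"
      using a k Rd_map_is_round by (auto simp: M.round_way_below_iff)
    then show ?thesis using L.kappa_way_below[OF I d(1)] by blast
  qed
  ultimately show "comult M (Rd_map L M f I) =
      Rd_map (Rd L) (Rd M) (Rd_map L M f) (comult L I)"
    unfolding lhs rhs by blast
qed

section \<open>The universal property of the counit\<close>

lemma frame_hom_compose:
  assumes "complete_lattice L" "f \<in> frame_hom L M" "g \<in> frame_hom M N"
  shows "compose (carrier L) g f \<in> frame_hom L N"
  unfolding frame_hom_def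
proof (intro CollectI conjI ballI allI impI)
  interpret L: complete_lattice L by fact
  note fD = frame_homD[OF assms(2)] and gD = frame_homD[OF assms(3)]
  have fc: "f a \<in> carrier M" if "a \<in> carrier L" for a using that fD(1) by auto
  show "compose (carrier L) g f \<in> carrier L \<rightarrow>\<^sub>E carrier N"
    using fc gD(1) by (auto simp: compose_def)
  show "compose (carrier L) g f \<top>\<^bsub>L\<^esub> = \<top>\<^bsub>N\<^esub>" by (simp add: compose_def fD gD)
  show "compose (carrier L) g f (a \<sqinter>\<^bsub>L\<^esub> b) = compose (carrier L) g f a \<sqinter>\<^bsub>N\<^esub> compose (carrier L) g f b"
    if "a \<in> carrier L" "b \<in> carrier L" for a b
    using that fc by (simp add: compose_def fD gD)
  show "compose (carrier L) g f (\<Squnion>\<^bsub>L\<^esub> S) = \<Squnion>\<^bsub>N\<^esub> (compose (carrier L) g f ` S)"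
    if S: "S \<subseteq> carrier L" for S
  proof -
    have "compose (carrier L) g f ` S = g ` f ` S"
      unfolding image_image using S by (intro image_cong) (auto simp: compose_def)
    moreover have "f ` S \<subseteq> carrier M" using S fc by auto
    ultimately show ?thesis using S by (simp add: compose_def fD gD)
  qed
qed

lemma pframe_hom_compose:
  assumes "complete_lattice L" "f \<in> pframe_hom L M" "g \<in> pframe_hom M N"
  shows "compose (carrier L) g f \<in> pframe_hom L N"
proof -
  have h: "f \<in> frame_hom L M" "g \<in> frame_hom M N" using assms by (auto simp: pframe_hom_def)
  show ?thesis
    using assms(2,3) frame_hom_compose[OF assms(1) h] frame_hom_closed[OF h(1)]
    by (simp add: pframe_hom_def compose_def)
qed

text \<open>Hence \<open>g\<close> is determined by its composite with the counit.\<close>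

lemma proper_hom_round_frame_eq:
  assumes "stably_compact_frame K" "proximity_frame L" "g \<in> proper_hom K (round_frame L)"
    and k: "k \<in> carrier K"
  shows "g k = {a \<in> carrier L. \<exists>j. j \<lless>\<^bsub>K\<^esub> k \<and> a \<prec>\<^bsub>L\<^esub> sigma L (g j)}"
proof -
  interpret K: stably_compact_frame K by fact
  interpret L: proximity_frame L by fact
  interpret R: frame "round_frame L" by (rule L.round_frame_frame)
  have gh: "g \<in> frame_hom K (round_frame L)"
    and gp: "\<And>i j. i \<lless>\<^bsub>K\<^esub> j \<Longrightarrow> g i \<lless>\<^bsub>round_frame L\<^esub> g j"
    using assms(3) by (auto simp: proper_hom_def way_below_carrier)
  have gr: "is_round_ideal L (g j)" if "j \<in> carrier K" for j
    using frame_hom_closed[OF gh that] by simp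
  have gc: "g j \<subseteq> carrier L" if "j \<in> carrier K" for j using gr[OF that] by (rule round_ideal_subset)
  \<comment> \<open>Since \<open>k\<close> is the join of \<open>D\<close>, the ideal
    \<open>g k\<close> is generated by the ideals \<open>g j\<close> with \<open>j\<close> way below
    \<open>k\<close>.\<close>
  define D where "D = {j \<in> carrier K. j \<lless>\<^bsub>K\<^esub> k}"
  have Dc: "D \<subseteq> carrier K" by (auto simp: D_def)
  have gD: "g ` D \<subseteq> Collect (is_round_ideal L)" using gr Dc by auto
  have gk: "g k = ideal_span L (g ` D)"
    using frame_homD(4)[OF gh Dc] K.way_below_approx[OF k] gD by (simp add: D_def L.round_frame_sup)
  have "\<exists>j. j \<lless>\<^bsub>K\<^esub> k \<and> a \<in> g j" if a: "a \<in> g k" for a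
  proof -
    obtain F where F: "finite F" "F \<subseteq> \<Union>(g ` D)" "a \<sqsubseteq>\<^bsub>L\<^esub> \<Squnion>\<^bsub>L\<^esub> F" "a \<in> carrier L"
      using a by (auto simp: gk ideal_span_def)
    obtain E where E: "finite E" "E \<subseteq> D" "F \<subseteq> \<Union>(g ` E)"
      using finite_subset_Union[OF F(1,2)] by (metis finite_subset_image)
    have Ec: "E \<subseteq> carrier K" using E Dc by auto
    \<comment> \<open>\<open>D\<close> is closed under finite joins, so the finitely many indices in
      \<open>E\<close> merge into a single \<open>j\<close>, and \<open>a\<close> lies in that one
      \<open>g j\<close>.\<close>
    have "\<Squnion>\<^bsub>K\<^esub> E \<in> D"
      using E k K.way_below_bottom K.way_below_join by (intro K.finite_sup_mem) (auto simp: D_def)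
    moreover have "a \<in> ideal_span L (g ` E)" using F E by (auto simp: ideal_span_def)
    moreover have "g (\<Squnion>\<^bsub>K\<^esub> E) = ideal_span L (g ` E)"
      using frame_homD(4)[OF gh Ec] gr Ec by (subst (asm) L.round_frame_sup) auto
    ultimately show ?thesis by (auto simp: D_def)
  qed
  moreover have "a \<prec>\<^bsub>L\<^esub> sigma L (g j)" if a: "j \<lless>\<^bsub>K\<^esub> k" "a \<in> g j" for a j
  proof -
    have j: "j \<in> carrier K" using a way_below_carrier by metis
    obtain b where b: "b \<in> g j" "a \<prec>\<^bsub>L\<^esub> b" using a gr[OF j] by (meson round_idealE)
    then have "b \<sqsubseteq>\<^bsub>L\<^esub> \<Squnion>\<^bsub>L\<^esub> (g j)" using gc[OF j] by (intro L.weak.sup_upper)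
    then show ?thesis
      using L.prox_trans_le[of a b "\<Squnion>\<^bsub>L\<^esub> (g j)"] a b gc[OF j] gr[OF j] by (auto simp: L.sigma_apply)
  qed
  moreover have "a \<in> g k" if a: "j \<lless>\<^bsub>K\<^esub> k" "a \<in> carrier L" "a \<prec>\<^bsub>L\<^esub> sigma L (g j)" for a j
  proof -
    have j: "j \<in> carrier K" using a way_below_carrier by metis
    \<comment> \<open>Properness enters here: \<open>g j\<close> is way below \<open>g k\<close>, so
      one member of \<open>g k\<close> bounds \<open>g j\<close> and therefore also its
      join.\<close>
    obtain b where b: "b \<in> g k" "\<And>x. x \<in> g j \<Longrightarrow> x \<sqsubseteq>\<^bsub>L\<^esub> b"
      using gp[OF a(1)] by (auto simp: L.round_way_below_iff)
    have bc: "b \<in> carrier L" using b gc[OF k] by auto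
    have s: "sigma L (g j) \<in> carrier L" "sigma L (g j) \<sqsubseteq>\<^bsub>L\<^esub> b"
      using b bc gc[OF j] gr[OF j] by (auto simp: L.sigma_apply intro: L.weak.sup_least)
    then have "a \<prec>\<^bsub>L\<^esub> b" using L.prox_trans_le a bc by blast
    then show ?thesis using gr[OF k] a b bc by (meson L.prox_le round_ideal_down)
  qed
  ultimately show ?thesis using gc[OF k] by blast
qed

lemma sigma_universal:
  assumes K: "stably_compact_frame K" and L: "proximity_frame L" and f: "f \<in> pframe_hom (wb_pframe K) L"
  shows "\<exists>!g. g \<in> proper_hom K (round_frame L) \<and> compose (carrier K) (sigma L) g = f"
proof (rule ex_ex1I)
  interpret W: proximity_frame "wb_pframe K" using K by (rule wb_pframe_proximity_frame)
  interpret f: proximity_hom "wb_pframe K" L f using W.proximity_frame_axioms L f by (rule proximity_homI)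
  define g where "g = compose (carrier K) (Rd_map (wb_pframe K) L f) (kappa (wb_pframe K))"
  have "g \<in> proper_hom K (round_frame L)"
    using pframe_hom_compose[OF W.complete_lattice_axioms stably_compact_kappa_hom[OF K] f.Rd_map_pframe_hom]
    by (simp add: g_def Rd_def[of L] pframe_hom_wb_pframe)
  moreover have "compose (carrier K) (sigma L) g = f"
  proof (rule extensionalityI[of _ "carrier K"])
    show "f \<in> extensional (carrier K)" using frame_homD(1)[OF f.frame_hom] by (auto simp: PiE_def)
    fix k assume k: "k \<in> carrier K"
    \<comment> \<open>The identity at \<open>k\<close> combines two facts: the join of
      \<open>Rd_map\<close> applied to \<open>kappa k\<close> is \<open>f\<close> of the join of
      \<open>kappa k\<close>, and the latter join is \<open>k\<close>.\<close>
    have r: "is_round_ideal (wb_pframe K) (kappa (wb_pframe K) k)" using k W.kappa_is_round by simp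
    show "compose (carrier K) (sigma L) g k = f k"
      using k r W.sigma_kappa[of k] f.sup_Rd_map[OF r] f.Rd_map_is_round[OF r]
      by (simp add: g_def compose_def f.M.sigma_apply W.sigma_apply)
  qed auto
  ultimately show "\<exists>g. g \<in> proper_hom K (round_frame L) \<and> compose (carrier K) (sigma L) g = f" by blast
next
  fix g h
  assume g: "g \<in> proper_hom K (round_frame L) \<and> compose (carrier K) (sigma L) g = f"
    and h: "h \<in> proper_hom K (round_frame L) \<and> compose (carrier K) (sigma L) h = f"
  \<comment> \<open>The formula for a proper homomorphism depends only on these values, so their
    agreement determines \<open>g\<close> and \<open>h\<close> on the carrier, and extensionality
    does the rest.\<close>
  have "sigma L (g j) = sigma L (h j)" if "j \<in> carrier K" for j
    using g h that by (metis compose_eq)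
  then have "g k = h k" if "k \<in> carrier K" for k
    using proper_hom_round_frame_eq[OF K L, of g k] proper_hom_round_frame_eq[OF K L, of h k] g h that
    by (auto simp: way_below_carrier)
  moreover have "g \<in> extensional (carrier K)" "h \<in> extensional (carrier K)"
    using g h by (auto simp: proper_hom_def frame_hom_def PiE_def)
  ultimately show "g = h" by (rule extensionalityI[rotated 2]) 
qed

(* The conjuncts are, in order: Rd is an endofunctor (4); comult and sigma are natural
   transformations (3); the comonad laws (1); comult is an isomorphism (1); stably compact frames
   with their way-below relation form a full subcategory (2); Rd takes values in it (2); and sigma
   is the counit of an adjunction with the inclusion as left adjoint (1). *)
theorem theorem4p7:
  shows
    "(\<forall>L :: 'a pframe. proximity_frame L \<longrightarrow> proximity_frame (Rd L)) \<and>
     (\<forall>(L :: 'a pframe) (M :: 'b pframe) f.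
        proximity_frame L \<and> proximity_frame M \<and> f \<in> pframe_hom L M \<longrightarrow>
        Rd_map L M f \<in> pframe_hom (Rd L) (Rd M)) \<and>
     (\<forall>L :: 'a pframe. proximity_frame L \<longrightarrow>
        Rd_map L L (\<lambda>x\<in>carrier L. x) = (\<lambda>I\<in>carrier (Rd L). I)) \<and>
     (\<forall>(L :: 'a pframe) (M :: 'b pframe) (N :: 'c pframe) f g.
        proximity_frame L \<and> proximity_frame M \<and> proximity_frame N \<and>
        f \<in> pframe_hom L M \<and> g \<in> pframe_hom M N \<longrightarrow>
        Rd_map L N (compose (carrier L) g f) =
          compose (carrier (Rd L)) (Rd_map M N g) (Rd_map L M f)) \<and>

     (\<forall>L :: 'a pframe. proximity_frame L \<longrightarrow>
        comult L \<in> pframe_hom (Rd L) (Rd (Rd L)) \<and> sigma L \<in> pframe_hom (Rd L) L) \<and>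
     (\<forall>(L :: 'a pframe) (M :: 'b pframe) f.
        proximity_frame L \<and> proximity_frame M \<and> f \<in> pframe_hom L M \<longrightarrow>
        compose (carrier (Rd L)) (comult M) (Rd_map L M f) =
          compose (carrier (Rd L)) (Rd_map (Rd L) (Rd M) (Rd_map L M f)) (comult L)) \<and>
     (\<forall>(L :: 'a pframe) (M :: 'b pframe) f.
        proximity_frame L \<and> proximity_frame M \<and> f \<in> pframe_hom L M \<longrightarrow>
        compose (carrier (Rd L)) (sigma M) (Rd_map L M f) =
          compose (carrier (Rd L)) f (sigma L)) \<and>

     (\<forall>L :: 'a pframe. proximity_frame L \<longrightarrow>
        compose (carrier (Rd L)) (Rd_map (Rd L) (Rd (Rd L)) (comult L)) (comult L) =
          compose (carrier (Rd L)) (comult (Rd L)) (comult L) \<and>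
        compose (carrier (Rd L)) (sigma (Rd L)) (comult L) = (\<lambda>I\<in>carrier (Rd L). I) \<and>
        compose (carrier (Rd L)) (Rd_map (Rd L) L (sigma L)) (comult L) =
          (\<lambda>I\<in>carrier (Rd L). I)) \<and>

     (\<forall>L :: 'a pframe. proximity_frame L \<longrightarrow> comult L \<in> pframe_iso (Rd L) (Rd (Rd L))) \<and>

     (\<forall>K :: 'd gorder. stably_compact_frame K \<longrightarrow> proximity_frame (wb_pframe K)) \<and>
     (\<forall>(K :: 'd gorder) (K' :: 'e gorder).
        stably_compact_frame K \<and> stably_compact_frame K' \<longrightarrow>
        pframe_hom (wb_pframe K) (wb_pframe K') = proper_hom K K') \<and>

     (\<forall>L :: 'a pframe. proximity_frame L \<longrightarrow>
        stably_compact_frame (round_frame L) \<and> Rd L = wb_pframe (round_frame L)) \<and>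
     (\<forall>(L :: 'a pframe) (M :: 'b pframe) f.
        proximity_frame L \<and> proximity_frame M \<and> f \<in> pframe_hom L M \<longrightarrow>
        Rd_map L M f \<in> proper_hom (round_frame L) (round_frame M)) \<and>

     (\<forall>(K :: 'd gorder) (L :: 'a pframe) f.
        stably_compact_frame K \<and> proximity_frame L \<and> f \<in> pframe_hom (wb_pframe K) L \<longrightarrow>
        (\<exists>!g. g \<in> proper_hom K (round_frame L) \<and> compose (carrier K) (sigma L) g = f))"
proof (intro conjI allI impI; (elim conjE)?)
  show "proximity_frame (Rd L)" if "proximity_frame L" for L :: "'a pframe"
    using that by (rule proximity_frame.Rd_proximity_frame)
  show "Rd_map L M f \<in> pframe_hom (Rd L) (Rd M)"
    if "proximity_frame L" "proximity_frame M" "f \<in> pframe_hom L M"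
    for L :: "'a pframe" and M :: "'b pframe" and f
    using proximity_hom.Rd_map_pframe_hom[OF proximity_homI[OF that]] .
  show "Rd_map L L (\<lambda>x\<in>carrier L. x) = (\<lambda>I\<in>carrier (Rd L). I)"
    if "proximity_frame L" for L :: "'a pframe"
    using that by (rule proximity_frame.Rd_map_id)
  show "Rd_map L N (compose (carrier L) g f) =
      compose (carrier (Rd L)) (Rd_map M N g) (Rd_map L M f)"
    if "proximity_frame L" "proximity_frame M" "proximity_frame N"
      "f \<in> pframe_hom L M" "g \<in> pframe_hom M N"
    for L :: "'a pframe" and M :: "'b pframe" and N :: "'c pframe" and f g
    using that by (intro Rd_map_compose proximity_homI)
  show "comult L \<in> pframe_hom (Rd L) (Rd (Rd L))" "sigma L \<in> pframe_hom (Rd L) L"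
    "compose (carrier (Rd L)) (Rd_map (Rd L) (Rd (Rd L)) (comult L)) (comult L) =
      compose (carrier (Rd L)) (comult (Rd L)) (comult L)"
    "compose (carrier (Rd L)) (sigma (Rd L)) (comult L) = (\<lambda>I\<in>carrier (Rd L). I)"
    "compose (carrier (Rd L)) (Rd_map (Rd L) L (sigma L)) (comult L) = (\<lambda>I\<in>carrier (Rd L). I)"
    "comult L \<in> pframe_iso (Rd L) (Rd (Rd L))" "stably_compact_frame (round_frame L)"
    if "proximity_frame L" for L :: "'a pframe"
  proof -
    interpret proximity_frame L by fact
    show "comult L \<in> pframe_hom (Rd L) (Rd (Rd L))" "sigma L \<in> pframe_hom (Rd L) L"
      by (rule comult_pframe_hom sigma_pframe_hom)+
    show "compose (carrier (Rd L)) (Rd_map (Rd L) (Rd (Rd L)) (comult L)) (comult L) =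
        compose (carrier (Rd L)) (comult (Rd L)) (comult L)"
      by (rule comult_coassoc)
    show "compose (carrier (Rd L)) (sigma (Rd L)) (comult L) = (\<lambda>I\<in>carrier (Rd L). I)"
      by (rule sigma_comult)
    show "compose (carrier (Rd L)) (Rd_map (Rd L) L (sigma L)) (comult L) = (\<lambda>I\<in>carrier (Rd L). I)"
      by (rule Rd_map_sigma_comult)
    show "comult L \<in> pframe_iso (Rd L) (Rd (Rd L))" "stably_compact_frame (round_frame L)"
      by (rule comult_pframe_iso round_frame_stably_compact)+
  qed
  show "compose (carrier (Rd L)) (comult M) (Rd_map L M f) =
      compose (carrier (Rd L)) (Rd_map (Rd L) (Rd M) (Rd_map L M f)) (comult L)"
    "compose (carrier (Rd L)) (sigma M) (Rd_map L M f) = compose (carrier (Rd L)) f (sigma L)"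
    "Rd_map L M f \<in> proper_hom (round_frame L) (round_frame M)"
    if "proximity_frame L" "proximity_frame M" "f \<in> pframe_hom L M"
    for L :: "'a pframe" and M :: "'b pframe" and f
  proof -
    interpret proximity_hom L M f using that by (rule proximity_homI)
    show "compose (carrier (Rd L)) (comult M) (Rd_map L M f) =
        compose (carrier (Rd L)) (Rd_map (Rd L) (Rd M) (Rd_map L M f)) (comult L)"
      by (rule comult_natural)
    show "compose (carrier (Rd L)) (sigma M) (Rd_map L M f) = compose (carrier (Rd L)) f (sigma L)"
      by (rule sigma_natural)
    show "Rd_map L M f \<in> proper_hom (round_frame L) (round_frame M)"
      by (rule Rd_map_proper_hom)
  qed
  show "proximity_frame (wb_pframe K)" if "stably_compact_frame K" for K :: "'d gorder"
    using that by (rule wb_pframe_proximity_frame)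
  show "pframe_hom (wb_pframe K) (wb_pframe K') = proper_hom K K'"
    for K :: "'d gorder" and K' :: "'e gorder"
    by (rule pframe_hom_wb_pframe)
  show "Rd L = wb_pframe (round_frame L)" for L :: "'a pframe"
    by (rule Rd_def)
  show "\<exists>!g. g \<in> proper_hom K (round_frame L) \<and> compose (carrier K) (sigma L) g = f"
    if "stably_compact_frame K" "proximity_frame L" "f \<in> pframe_hom (wb_pframe K) L"
    for K :: "'d gorder" and L :: "'a pframe" and f
    using that by (rule sigma_universal)
qed

end
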